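(* Let $f$ be a twist map of the annulus, let $c\in\mathbb{R}$, and let $u_c:\mathbb{R}\to\mathbb{R}$ be a discrete weak K.A.M. solution for $f$ at cohomology class $c$. Then the map $$\Lambda_c:\operatorname{Graph}(c+\nabla^+u_c)\to\operatorname{Graph}(c+\nabla^+u_c),\qquad (x,p)\mapsto(y,\partial_2S(x,y)),$$ where $y$ is implicitly given by $T^+[u_c](x)=u_c(y)-S_c(x,y)$, is well-defined. Moreover, $\Lambda_c$ satisfies the following properties: (i) $\Lambda_c(x+1,p)=\Lambda_c(x,p)+(1,0)$; (ii) $\Lambda_c$ is Lipschitz continuous; (iii) $\Lambda_c$ preserves the orientation of the full pseudo-graph $\operatorname{Graph}(c+\nabla^+u_c)$; (iv) the image of a vertical segment under $\Lambda_c$ is a point that belongs to a vertical segment; (v) $\Lambda_c$ admits a rotation number for positive iterations, that is, $\rho(\Lambda_c):=\lim_{n\to+\infty}\frac1n\left(\pi_1\circ\Lambda_c^n(x,p)-x\right)$ exists for all $(x,p)\in\operatorname{Graph}(c+\nabla^+u_c)$ and is independent of $(x,p)$; in fact $\rho(\Lambda_c)=\alpha'(c)$.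
   Context: Let $\mathbb{T}=\mathbb{R}/\mathbb{Z}$. A twist map of the annulus is a $C^1$-diffeomorphism $f:\mathbb{T}\times\mathbb{R}\to\mathbb{T}\times\mathbb{R}$ such that: (1) $f$ is isotopic to the identity; (2) $f$ is exact symplectic, i.e. if $f(\theta,p)=(\theta',p')$ then the $1$-form $p'd\theta'-p\,d\theta$ is exact; (3) if $F:\mathbb{R}^2\to\mathbb{R}^2$, $F(x,p)=(y,p')$, is a lift of $f$, there is $\varepsilon>0$ with $0<\frac{\partial y}{\partial p}(x,p)<\frac1\varepsilon$ for all $(x,p)$. Fix a lift $F$ of $f$. Its generating function is a $C^2$ function $S:\mathbb{R}^2\to\mathbb{R}$ (which exists and is unique up to an additive constant) such that $S(x+1,y+1)=S(x,y)$; there is $\varepsilon>0$ with $\frac{\partial^2S}{\partial x\partial y}<-\varepsilon$ everywhere; and $F(x,p)=(y,p')$ if and only if $p=-\partial_1S(x,y)$ and $p'=\partial_2S(x,y)$. For $c\in\mathbb{R}$ put $S_c(x,y)=S(x,y)+c(x-y)$. For a bounded $1$-periodic $u:\mathbb{R}\to\mathbb{R}$ put $T^-[u](x)=\inf_{y\in\mathbb{R}}\{u(y)+S_c(y,x)\}$ and $T^+[u](x)=\sup_{y\in\mathbb{R}}\{u(y)-S_c(x,y)\}$. There is a unique constant $\overline{S}_c\in\mathbb{R}$ for which $u=T^-[u]-\overline{S}_c$ has a continuous $1$-periodic solution $u$; any such solution is called a discrete weak K.A.M. solution for $f$ at cohomology class $c$. Mather's function is $\alpha(c)=-\overline{S}_c$;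 it is differentiable at every $c\in\mathbb{R}$. For continuous $u:\mathbb{R}\to\mathbb{R}$, $\nabla^+u(x)=\{p\in\mathbb{R}:\limsup_{y\to x}\frac{u(y)-u(x)-p(y-x)}{|y-x|}\le0\}$. The full pseudo-graph is $\operatorname{Graph}(c+\nabla^+u_c)=\{(x,c+p):x\in\mathbb{R},\ p\in\nabla^+u_c(x)\}$. If $x\in\operatorname{Sing}(u_c)$, i.e. $u_c$ is not differentiable at $x$, then $\nabla^+u_c(x)$ is not a singleton and $\{x\}\times(c+\nabla^+u_c(x))$ is called a vertical segment of the full pseudo-graph. $\pi_1$ is the projection on the first coordinate. Orientation: the full pseudo-graph is a curve, oriented (from left to right, vertical segments being traversed downwards) by the total order $(x,p)\preceq(x',p')$ iff $x<x'$, or $x=x'$ and $p\ge p'$. "Preserves the orientation" means that $\Lambda_c$ is non-decreasing (not necessarily strictly) for this order. *)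

theory Defs
  imports "HOL-Analysis.Analysis"
begin

definition C1 :: "('a::real_normed_vector \<Rightarrow> 'b::real_normed_vector) \<Rightarrow> bool" where
  "C1 g \<longleftrightarrow> (\<exists>g' :: 'a \<Rightarrow> ('a \<Rightarrow>\<^sub>L 'b).
     (\<forall>z. (g has_derivative blinfun_apply (g' z)) (at z)) \<and> continuous_on UNIV g')"

definition C2 :: "('a::real_normed_vector \<Rightarrow> 'b::real_normed_vector) \<Rightarrow> bool" where
  "C2 g \<longleftrightarrow> (\<exists>g' :: 'a \<Rightarrow> ('a \<Rightarrow>\<^sub>L 'b).
     (\<forall>z. (g has_derivative blinfun_apply (g' z)) (at z)) \<and> C1 g')"

definition d1 :: "(real \<times> real \<Rightarrow> real) \<Rightarrow> real \<times> real \<Rightarrow> real" where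
  "d1 g z = deriv (\<lambda>t. g (t, snd z)) (fst z)"

definition d2 :: "(real \<times> real \<Rightarrow> real) \<Rightarrow> real \<times> real \<Rightarrow> real" where
  "d2 g z = deriv (\<lambda>t. g (fst z, t)) (snd z)"


text \<open>The circle \<open>\<real>/\<int>\<close> is realised as the unit circle of the complex plane through
  \<open>x \<mapsto> exp (2 \<pi> i x)\<close>, so the universal covering of the annulus is \<open>proj\<close>.  Maps of the annulus
  are total functions, of which only the values on \<open>annulus\<close> matter.\<close>

definition annulus :: "(complex \<times> real) set" where
  "annulus = sphere 0 1 \<times> UNIV"

definition proj :: "real \<times> real \<Rightarrow> complex \<times> real" where
  "proj z = (cis (2 * pi * fst z), snd z)"

text \<open>As \<open>proj\<close> is a local diffeomorphism onto the submanifold \<open>annulus\<close>, a map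
  \<open>g\<close> of the annulus is \<open>C\<^sup>1\<close> iff \<open>g \<circ> proj\<close> is.\<close>

definition annulus_C1 :: "(complex \<times> real \<Rightarrow> complex \<times> real) \<Rightarrow> bool" where
  "annulus_C1 g \<longleftrightarrow> g \<in> annulus \<rightarrow> annulus \<and> C1 (g \<circ> proj)"

definition annulus_diffeo :: "(complex \<times> real \<Rightarrow> complex \<times> real) \<Rightarrow> bool" where
  "annulus_diffeo f \<longleftrightarrow> bij_betw f annulus annulus \<and> annulus_C1 f \<and>
     annulus_C1 (inv_into annulus f)"

definition isotopic_to_id :: "(complex \<times> real \<Rightarrow> complex \<times> real) \<Rightarrow> bool" where
  "isotopic_to_id f \<longleftrightarrow> homotopic_with_canon annulus_diffeo annulus annulus id f"

definition is_lift ::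
  "(real \<times> real \<Rightarrow> real \<times> real) \<Rightarrow> (complex \<times> real \<Rightarrow> complex \<times> real) \<Rightarrow> bool" where
  "is_lift F f \<longleftrightarrow> continuous_on UNIV F \<and> (\<forall>z. proj (F z) = f (proj z))"

text \<open>With \<open>F (x, p) = (y, p')\<close>, the linear form below is \<open>p' dy - p dx\<close>, the pull-back by
  \<open>proj\<close> of \<open>p' d\<theta>' - p d\<theta>\<close>; the primitive \<open>h\<close> is a function on the annulus.\<close>

definition exact_symplectic :: "(complex \<times> real \<Rightarrow> complex \<times> real) \<Rightarrow> bool" where
  "exact_symplectic f \<longleftrightarrow> (\<forall>F. is_lift F f \<longrightarrow>
     (\<exists>h :: complex \<times> real \<Rightarrow> real. \<forall>z.
        ((h \<circ> proj) has_derivative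
           (\<lambda>v. snd (F z) * fst (frechet_derivative F (at z) v) - snd z * fst v)) (at z)))"

definition twist_condition :: "(complex \<times> real \<Rightarrow> complex \<times> real) \<Rightarrow> bool" where
  "twist_condition f \<longleftrightarrow> (\<forall>F. is_lift F f \<longrightarrow>
     (\<exists>\<epsilon>>0. \<forall>z. 0 < d2 (fst \<circ> F) z \<and> d2 (fst \<circ> F) z < 1 / \<epsilon>))"

definition twist_map :: "(complex \<times> real \<Rightarrow> complex \<times> real) \<Rightarrow> bool" where
  "twist_map f \<longleftrightarrow>
     annulus_diffeo f \<and> isotopic_to_id f \<and> exact_symplectic f \<and> twist_condition f"

definition generating_function ::
  "(real \<times> real \<Rightarrow> real) \<Rightarrow> (real \<times> real \<Rightarrow> real \<times> real) \<Rightarrow> bool" where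
  "generating_function S F \<longleftrightarrow>
     C2 S \<and>
     (\<forall>x y. S (x + 1, y + 1) = S (x, y)) \<and>
     (\<exists>\<epsilon>>0. \<forall>z. d1 (d2 S) z < - \<epsilon>) \<and>
     (\<forall>x p y p'. F (x, p) = (y, p') \<longleftrightarrow> p = - d1 S (x, y) \<and> p' = d2 S (x, y))"


definition Sc :: "(real \<times> real \<Rightarrow> real) \<Rightarrow> real \<Rightarrow> real \<times> real \<Rightarrow> real" where
  "Sc S c = (\<lambda>(x, y). S (x, y) + c * (x - y))"

text \<open>For bounded \<open>u\<close> and a generating function \<open>S\<close>, coercivity of \<open>S\<close> makes the infimum and the
  supremum below finite.\<close>

definition Tminus :: "(real \<times> real \<Rightarrow> real) \<Rightarrow> real \<Rightarrow> (real \<Rightarrow> real) \<Rightarrow> real \<Rightarrow> real" where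
  "Tminus S c u x = (INF y. u y + Sc S c (y, x))"

definition Tplus :: "(real \<times> real \<Rightarrow> real) \<Rightarrow> real \<Rightarrow> (real \<Rightarrow> real) \<Rightarrow> real \<Rightarrow> real" where
  "Tplus S c u x = (SUP y. u y - Sc S c (x, y))"

definition weak_KAM_eq ::
  "(real \<times> real \<Rightarrow> real) \<Rightarrow> real \<Rightarrow> real \<Rightarrow> (real \<Rightarrow> real) \<Rightarrow> bool" where
  "weak_KAM_eq S c s u \<longleftrightarrow> continuous_on UNIV u \<and> (\<forall>x. u (x + 1) = u x) \<and>
     (\<forall>x. u x = Tminus S c u x - s)"

definition Sbar :: "(real \<times> real \<Rightarrow> real) \<Rightarrow> real \<Rightarrow> real" where
  "Sbar S c = (THE s. \<exists>u. weak_KAM_eq S c s u)"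

definition weak_KAM_solution ::
  "(real \<times> real \<Rightarrow> real) \<Rightarrow> real \<Rightarrow> (real \<Rightarrow> real) \<Rightarrow> bool" where
  "weak_KAM_solution S c u \<longleftrightarrow> weak_KAM_eq S c (Sbar S c) u"

definition mather_alpha :: "(real \<times> real \<Rightarrow> real) \<Rightarrow> real \<Rightarrow> real" where
  "mather_alpha S c = - Sbar S c"


definition superdiff :: "(real \<Rightarrow> real) \<Rightarrow> real \<Rightarrow> real set" where
  "superdiff u x =
     {p. Limsup (at x) (\<lambda>y. ereal ((u y - u x - p * (y - x)) / \<bar>y - x\<bar>)) \<le> 0}"

definition Sing :: "(real \<Rightarrow> real) \<Rightarrow> real set" where
  "Sing u = {x. \<not> u differentiable (at x)}"

definition pseudo_graph :: "real \<Rightarrow> (real \<Rightarrow> real) \<Rightarrow> (real \<times> real) set" where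
  "pseudo_graph c u = {(x, c + p) | x p. p \<in> superdiff u x}"

definition vertical_segments :: "real \<Rightarrow> (real \<Rightarrow> real) \<Rightarrow> (real \<times> real) set set" where
  "vertical_segments c u = {{x} \<times> ((+) c ` superdiff u x) | x. x \<in> Sing u}"

definition pg_le :: "real \<times> real \<Rightarrow> real \<times> real \<Rightarrow> bool" where
  "pg_le z z' \<longleftrightarrow> fst z < fst z' \<or> fst z = fst z' \<and> snd z \<ge> snd z'"

text \<open>The relation between \<open>x\<close> and \<open>y\<close> in the implicit definition of the map \<open>\<Lambda>\<^sub>c\<close>.\<close>

definition Lam_rel ::
  "(real \<times> real \<Rightarrow> real) \<Rightarrow> real \<Rightarrow> (real \<Rightarrow> real) \<Rightarrow> real \<Rightarrow> real \<Rightarrow> bool" where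
  "Lam_rel S c u x y \<longleftrightarrow> Tplus S c u x = u y - Sc S c (x, y)"

definition Lam ::
  "(real \<times> real \<Rightarrow> real) \<Rightarrow> real \<Rightarrow> (real \<Rightarrow> real) \<Rightarrow> real \<times> real \<Rightarrow> real \<times> real" where
  "Lam S c u = (\<lambda>(x, p). let y = (THE y. Lam_rel S c u x y) in (y, d2 S (x, y)))"

end

theory Submission
  imports Defs
begin

text \<open>Write \<open>H x y = S (x, y) + c * (x - y)\<close> and \<open>s = Sbar S c\<close>.  The defect \<open>u x + H x y - s - u y\<close> is never negative,
and every \<open>y\<close> has predecessors \<open>x\<close> of defect \<open>0\<close>, which are called calibrated.  Such an \<open>x\<close> is a
point of differentiability of \<open>u\<close>, where \<open>u'\<close> and the twist determine \<open>y\<close>; together with the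
rectangle form of the twist condition this makes calibrated pairs strictly monotone
(\<open>calibrated_less\<close>).  On the other hand, a point \<open>y\<close> that maximises \<open>u y - H x y\<close> has \<open>x\<close> between two of
its calibrated predecessors (\<open>maximizer_between_calibrated\<close>).  So the maximiser is unique, and
\<open>\<Lambda>\<^sub>c\<close> is the generalised inverse \<open>g\<close> of the monotone relation of calibrated
predecessors, read on the first coordinate.  A vertical segment collapses because \<open>\<Lambda>\<^sub>c\<close> depends on that
coordinate only.  Its image is over a singular point: a singular point is never calibrated, whereas
\<open>g\<close> sends to a point of differentiability only the calibrated predecessor of that point
(\<open>g_singular\<close>).  The map is Lipschitz because \<open>u\<close> is semiconcave and
differentiable at the calibrated points (\<open>g_lipschitz\<close>).

As \<open>g\<close> is a monotone map of degree one, it has a rotation number \<open>\<rho>\<close>, with an error that is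
uniform along all orbits.  Comparing actions along long calibrated orbits shows that \<open>\<rho>\<close> is a subgradient
of \<open>\<alpha>\<close> at \<open>c\<close> (\<open>rotation_number_subgradient\<close>).  For differentiability, the subgradients \<open>\<rho>'\<close>
at nearby classes must converge to \<open>\<rho>\<close>.  A calibrated orbit for a nearby class has a small average
defect with respect to \<open>u\<close>, so long pieces of it stay close to orbits of \<open>g\<close>, which compares the two
rotation numbers (\<open>rotation_number_stable\<close>).

All this presupposes that \<open>Sbar\<close> is well-defined for every class: a solution is obtained as the limit of
a monotone sequence of normalised iterates of the Lax-Oleinik operator
(\<open>kam_solution_exists\<close>).\<close>

section \<open>Quasi-additive sequences and periodic functions\<close>

text \<open>Every quotient \<open>(a n - D) / n\<close> lies below every \<open>(a m + D) / m\<close>, because \<open>a (m * n)\<close> can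
be estimated by splitting it into \<open>m\<close> blocks or into \<open>n\<close> blocks; any number in between is a
rate.  The uniform error \<open>D\<close> matters: it is what makes rotation numbers comparable along finite
orbits.  The lemma is applied to the iterates of the Lax-Oleinik operator and to those of a
monotone circle map of degree one.\<close>

lemma quasi_additive_rate:
  fixes a :: "nat \<Rightarrow> real"
  assumes qa: "\<And>m n. \<bar>a (m + n) - a m - a n\<bar> \<le> D"
  shows "\<exists>\<rho>. \<forall>n. \<bar>a n - real n * \<rho>\<bar> \<le> D"
proof -
  have up: "a (Suc m * n) \<le> real (Suc m) * a n + real m * D" for m n
  proof (induction m)
    case (Suc m)
    show ?case using qa[of n "Suc m * n"] Suc by (simp add: algebra_simps)
  qed simp
  have lo: "a (Suc m * n) \<ge> real (Suc m) * a n - real m * D" for m n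
  proof (induction m)
    case (Suc m)
    show ?case using qa[of n "Suc m * n"] Suc by (simp add: algebra_simps)
  qed simp
  have D: "D \<ge> 0" using qa[of 0 0] by simp
  have sep: "(a n - D) / real n \<le> (a m + D) / real m" if "n > 0" "m > 0" for n m
  proof -
    obtain m' n' where mn: "m = Suc m'" "n = Suc n'" using \<open>m > 0\<close> \<open>n > 0\<close> by (metis gr0_conv_Suc)
    have "real m * a n - real m' * D \<le> real n * a m + real n' * D"
      using lo[of m' n] up[of n' m] mn by (metis mult.commute order_trans)
    moreover have "real m' * D \<le> real m * D" "real n' * D \<le> real n * D"
      using D mn by (auto intro!: mult_right_mono)
    ultimately have "real m * (a n - D) \<le> real n * (a m + D)" by (simp add: algebra_simps)
    thus ?thesis using that by (simp add: divide_simps mult.commute)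
  qed
  define \<rho> where "\<rho> = (SUP n\<in>{0<..}. (a n - D) / real n)"
  have bdd: "bdd_above ((\<lambda>n. (a n - D) / real n) ` {0<..})"
    using sep[of _ 1] by (intro bdd_aboveI2[of _ _ "(a 1 + D) / real 1"]) auto
  have "\<bar>a n - real n * \<rho>\<bar> \<le> D" for n
  proof (cases "n = 0")
    case True
    thus ?thesis using qa[of 0 0] by simp
  next
    case False
    have "(a n - D) / real n \<le> \<rho>"
      unfolding \<rho>_def by (rule cSUP_upper[OF _ bdd]) (use False in auto)
    moreover have "\<rho> \<le> (a n + D) / real n"
      unfolding \<rho>_def by (rule cSUP_least) (use sep False in auto)
    ultimately show ?thesis using False by (simp add: field_simps abs_le_iff)
  qed
  thus ?thesis by blast
qed

lemma periodic_int:
  fixes u :: "real \<Rightarrow> 'a"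
  assumes "\<And>x. u (x + 1) = u x"
  shows "u (x + of_int n) = u x"
proof (induction n rule: int_induct[of _ 0])
  case (step1 i) thus ?case using assms[of "x + of_int i"] by (simp add: add.assoc)
next
  case (step2 i) thus ?case using assms[of "x + of_int (i - 1)"] by simp
qed simp

lemma periodic_continuous_bounded:
  fixes u :: "real \<Rightarrow> real"
  assumes per: "\<And>x. u (x + 1) = u x" and "continuous_on UNIV u"
  obtains U where "\<And>x. \<bar>u x\<bar> \<le> U"
proof -
  have "bounded (u ` {0..1})"
    using compact_continuous_image[OF continuous_on_subset[OF assms(2)] compact_Icc]
      compact_imp_bounded by blast
  then obtain U where U: "\<And>x. x \<in> {0..1} \<Longrightarrow> \<bar>u x\<bar> \<le> U"
    unfolding bounded_iff by fastforce
  have "\<bar>u x\<bar> \<le> U" for x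
  proof -
    have "u x = u (x + of_int (- \<lfloor>x\<rfloor>))" by (rule periodic_int[of u, symmetric]) (rule per)
    also have "\<bar>\<dots>\<bar> \<le> U" by (rule U) (simp; linarith)
    finally show ?thesis .
  qed
  thus ?thesis using that by blast
qed

section \<open>Twist kernels\<close>

text \<open>The kernel \<open>H x y\<close> stands for \<open>S (x, y) + c * (x - y)\<close>.  The inequality \<open>rect\<close> is the twist condition
integrated over a rectangle; this form has no mixed derivatives in it, so it is symmetric in the
two variables.  The strip condition is what periodicity and compactness leave of the \<open>C\<^sup>2\<close>
hypothesis.\<close>

locale twist_kernel =
  fixes H h1 h2 :: "real \<Rightarrow> real \<Rightarrow> real" and \<epsilon> :: real
  assumes eps: "\<epsilon> > 0"
    and per: "\<And>x y. H (x + 1) (y + 1) = H x y"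
    and DERIV1: "\<And>x y. ((\<lambda>t. H t y) has_real_derivative h1 x y) (at x)"
    and DERIV2: "\<And>x y. ((\<lambda>t. H x t) has_real_derivative h2 x y) (at y)"
    and rect: "\<And>x x' y y'. x \<le> x' \<Longrightarrow> y \<le> y' \<Longrightarrow>
                 H x' y' + H x y \<le> H x y' + H x' y - \<epsilon> * (x' - x) * (y' - y)"
    and strip_lipschitz: "\<And>R g. g \<in> {H, h1, h2} \<Longrightarrow> \<exists>K\<ge>0. \<forall>x y x' y'. \<bar>x - y\<bar> \<le> R \<longrightarrow> \<bar>x' - y'\<bar> \<le> R \<longrightarrow>
                 \<bar>g x y - g x' y'\<bar> \<le> K * (\<bar>x - x'\<bar> + \<bar>y - y'\<bar>)"
begin

lemma per_int: "H (x + of_int n) (y + of_int n) = H x y"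
proof (induction n rule: int_induct[of _ 0])
  case (step1 i) thus ?case using per[of "x + of_int i" "y + of_int i"] by (simp add: add.assoc)
next
  case (step2 i) thus ?case using per[of "x + of_int (i - 1)" "y + of_int (i - 1)"] by simp
qed simp

text \<open>Divide \<open>rect\<close> by the width of the rectangle and let it tend to \<open>0\<close>.\<close>

lemma h1_twist:
  assumes "y \<le> y'"
  shows "h1 x y' \<le> h1 x y - \<epsilon> * (y' - y)"
proof -
  let ?q = "\<lambda>t y. (H t y - H x y) / (t - x)"
  have lim: "((\<lambda>t. ?q t y) \<longlongrightarrow> h1 x y) (at_right x)" for y
    using DERIV1[of y x] unfolding has_field_derivative_iff
    by (rule tendsto_within_subset) auto
  have "h1 x y' - h1 x y \<le> - \<epsilon> * (y' - y)"
  proof (rule tendsto_upperbound)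
    show "((\<lambda>t. ?q t y' - ?q t y) \<longlongrightarrow> h1 x y' - h1 x y) (at_right x)" by (intro tendsto_intros lim)
    show "\<forall>\<^sub>F t in at_right x. ?q t y' - ?q t y \<le> - \<epsilon> * (y' - y)"
      unfolding eventually_at_right_field
    proof (intro exI[of _ "x + 1"] conjI allI impI)
      fix t assume "x < t"
      thus "?q t y' - ?q t y \<le> - \<epsilon> * (y' - y)"
        using rect[of x t y y'] assms
        by (subst diff_divide_distrib[symmetric], subst pos_divide_le_eq) (auto simp: algebra_simps)
    qed simp
  qed simp
  thus ?thesis by simp
qed

lemma h2_twist:
  assumes "x \<le> x'"
  shows "h2 x' y \<le> h2 x y - \<epsilon> * (x' - x)"
proof -
  let ?q = "\<lambda>t x. (H x t - H x y) / (t - y)"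
  have lim: "((\<lambda>t. ?q t x) \<longlongrightarrow> h2 x y) (at_right y)" for x
    using DERIV2[of x y] unfolding has_field_derivative_iff
    by (rule tendsto_within_subset) auto
  have "h2 x' y - h2 x y \<le> - \<epsilon> * (x' - x)"
  proof (rule tendsto_upperbound)
    show "((\<lambda>t. ?q t x' - ?q t x) \<longlongrightarrow> h2 x' y - h2 x y) (at_right y)" by (intro tendsto_intros lim)
    show "\<forall>\<^sub>F t in at_right y. ?q t x' - ?q t x \<le> - \<epsilon> * (x' - x)"
      unfolding eventually_at_right_field
    proof (intro exI[of _ "y + 1"] conjI allI impI)
      fix t assume "y < t"
      thus "?q t x' - ?q t x \<le> - \<epsilon> * (x' - x)"
        using rect[of x x' y t] assms
        by (subst diff_divide_distrib[symmetric], subst pos_divide_le_eq) (auto simp: algebra_simps)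
    qed simp
  qed simp
  thus ?thesis by simp
qed

text \<open>A strip around the diagonal is compact modulo the diagonal translation by integers.\<close>

lemma strip_bounded: "\<exists>M\<ge>0. \<forall>x y. \<bar>x - y\<bar> \<le> R \<longrightarrow> \<bar>H x y\<bar> \<le> M"
proof -
  obtain K where K: "K \<ge> 0" "\<And>x y x' y'. \<bar>x - y\<bar> \<le> \<bar>R\<bar> \<Longrightarrow> \<bar>x' - y'\<bar> \<le> \<bar>R\<bar> \<Longrightarrow>
      \<bar>H x y - H x' y'\<bar> \<le> K * (\<bar>x - x'\<bar> + \<bar>y - y'\<bar>)" using strip_lipschitz[of H "\<bar>R\<bar>"] by blast
  have "\<bar>H x y\<bar> \<le> \<bar>H 0 0\<bar> + K * (\<bar>R\<bar> + 2)" if "\<bar>x - y\<bar> \<le> R" for x y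
  proof -
    define n where "n = - \<lfloor>x\<rfloor>"
    have "\<bar>x + of_int n\<bar> \<le> 1" unfolding n_def by simp linarith
    moreover have "\<bar>y + of_int n\<bar> \<le> \<bar>R\<bar> + 1" using that calculation by linarith
    ultimately have "K * (\<bar>x + of_int n - 0\<bar> + \<bar>y + of_int n - 0\<bar>) \<le> K * (\<bar>R\<bar> + 2)"
      by (intro mult_left_mono K) auto
    moreover have "\<bar>H (x + of_int n) (y + of_int n) - H 0 0\<bar> \<le> K * (\<bar>x + of_int n - 0\<bar> + \<bar>y + of_int n - 0\<bar>)"
      by (rule K) (use that in auto)
    ultimately show ?thesis unfolding per_int by linarith
  qed
  moreover have "\<bar>H 0 0\<bar> + K * (\<bar>R\<bar> + 2) \<ge> 0" using K by simp
  ultimately show ?thesis by blast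
qed

lemma continuous_H: "continuous_on UNIV (\<lambda>z. H (fst z) (snd z))"
proof -
  have "isCont (\<lambda>z. H (fst z) (snd z)) z" for z
  proof -
    define R where "R = \<bar>fst z - snd z\<bar> + 2"
    obtain K where K: "K \<ge> 0" "\<And>x y x' y'. \<bar>x - y\<bar> \<le> R \<Longrightarrow> \<bar>x' - y'\<bar> \<le> R \<Longrightarrow>
        \<bar>H x y - H x' y'\<bar> \<le> K * (\<bar>x - x'\<bar> + \<bar>y - y'\<bar>)" using strip_lipschitz[of H R] by blast
    have "((\<lambda>w. H (fst w) (snd w) - H (fst z) (snd z)) \<longlongrightarrow> 0) (at z)"
    proof (rule Lim_null_comparison)
      show "((\<lambda>w. K * (\<bar>fst w - fst z\<bar> + \<bar>snd w - snd z\<bar>)) \<longlongrightarrow> 0) (at z)"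
        by (auto intro!: tendsto_eq_intros)
      have "\<forall>\<^sub>F w in at z. dist w z < 1" by (simp add: eventually_at_ball' eventually_at, rule exI[of _ 1], simp)
      thus "\<forall>\<^sub>F w in at z. norm (H (fst w) (snd w) - H (fst z) (snd z)) \<le> K * (\<bar>fst w - fst z\<bar> + \<bar>snd w - snd z\<bar>)"
      proof eventually_elim
        case (elim w)
        have "\<bar>fst w - fst z\<bar> < 1" "\<bar>snd w - snd z\<bar> < 1"
          using dist_fst_le[of w z] dist_snd_le[of w z] elim by (auto simp: dist_real_def)
        thus ?case unfolding real_norm_def by (intro K(2)) (auto simp: R_def)
      qed
    qed
    thus ?thesis unfolding isCont_def by (rule Lim_null[THEN iffD2])
  qed
  thus ?thesis by (simp add: continuous_at_imp_continuous_on)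
qed

lemma continuous_on_H [continuous_intros]:
  assumes "continuous_on A f" "continuous_on A g"
  shows "continuous_on A (\<lambda>x. H (f x) (g x))"
  using continuous_on_compose2[OF continuous_H continuous_on_Pair[OF assms]] by simp

text \<open>Applying \<open>rect\<close> to a unit square, and moving one of its corners back by periodicity, bounds the second
differences of \<open>n \<mapsto> H x (y + n)\<close> below by \<open>\<epsilon>\<close>.  Hence \<open>H\<close> grows quadratically away from the
diagonal.\<close>

lemma coercive: "\<exists>R>0. \<forall>x y. \<bar>x - y\<bar> > R \<longrightarrow> H x y > B"
proof -
  obtain M where M: "M \<ge> 0" "\<And>x y. \<bar>x - y\<bar> \<le> 2 \<Longrightarrow> \<bar>H x y\<bar> \<le> M"
    using strip_bounded[of 2] by blast
  define P where "P = (\<lambda>n. \<epsilon> * (real n * (real n - 1) / 2) - M - 2 * M * real n)"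
  \<comment> \<open>A sequence whose second differences are at least \<open>\<epsilon>\<close> grows quadratically.\<close>
  have conv: "\<psi> n \<ge> P n"
    if d: "\<And>n. \<psi> (Suc (Suc n)) - \<psi> (Suc n) \<ge> \<psi> (Suc n) - \<psi> n + \<epsilon>"
      and b: "\<bar>\<psi> 0\<bar> \<le> M" "\<bar>\<psi> 1\<bar> \<le> M" for \<psi> :: "nat \<Rightarrow> real" and n
  proof -
    have inc: "\<psi> (Suc n) - \<psi> n \<ge> \<epsilon> * real n - 2 * M" for n
    proof (induction n)
      case (Suc n)
      thus ?case using d[of n] by (simp add: algebra_simps)
    qed (use b in simp)
    show ?thesis unfolding P_def
    proof (induction n)
      case (Suc n)
      thus ?case using inc[of n] by (simp add: field_simps)
    qed (use b in simp)
  qed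
  \<comment> \<open>For such \<open>n\<close> the quadratic term of \<open>P n\<close> exceeds \<open>(2 * M + 1) * n\<close>, and \<open>n\<close> itself exceeds \<open>B + M\<close>.\<close>
  define N where "N = nat \<lceil>(4 * M + 2) / \<epsilon>\<rceil> + nat \<lceil>\<bar>B\<bar> + M\<rceil> + 1"
  have N: "P n > B" if "n \<ge> N" for n
  proof -
    have "real n - 1 \<ge> (4 * M + 2) / \<epsilon>" "real n > B + M" and n: "real n \<ge> 1"
      using that unfolding N_def by linarith+
    hence "\<epsilon> * (real n - 1) / 2 \<ge> 2 * M + 1" using eps by (simp add: field_simps)
    from mult_left_mono[OF this, of "real n"] n \<open>real n > B + M\<close>
    show ?thesis unfolding P_def by (simp add: algebra_simps)
  qed
  have "H x y > B" if far: "\<bar>x - y\<bar> > real N + 1" for x y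
  proof -
    define n where "n = \<lfloor>y - x\<rfloor>"
    define y0 where "y0 = y - of_int n"
    have y0: "0 \<le> y0 - x" "y0 - x < 1" unfolding y0_def n_def by linarith+
    have second: "H x (t + 1) - H x t \<ge> H x t - H x (t - 1) + \<epsilon>" for t
      using rect[of x "x + 1" t "t + 1"] per[of x t] per[of x "t - 1"] by simp
    have "H x (y0 + real k) \<ge> P k" for k
      by (rule conv) (use y0 second[of "y0 + real k + 1" for k] M in \<open>auto simp: algebra_simps\<close>)
    moreover have "H x (y0 - real k) \<ge> P k" for k
    proof (rule conv)
      fix k
      show "H x (y0 - real (Suc k)) - H x (y0 - real k) + \<epsilon> \<le> H x (y0 - real (Suc (Suc k))) - H x (y0 - real (Suc k))"
        using second[of "y0 - real (Suc k)"] by (simp add: algebra_simps)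
    qed (use y0 M in auto)
    moreover have "y = y0 + real (nat n) \<or> y = y0 - real (nat (- n))" unfolding y0_def by linarith
    moreover have "n \<ge> 0 \<Longrightarrow> nat n \<ge> N" "n < 0 \<Longrightarrow> nat (-n) \<ge> N" using far unfolding n_def by linarith+
    ultimately show ?thesis using N unfolding y0_def
      by (smt (verit, ccfv_threshold) of_nat_nat of_int_minus)
  qed
  thus ?thesis by (intro exI[of _ "real N + 1"]) auto
qed

lemma bounded_below: "\<exists>m. \<forall>x y. m \<le> H x y"
proof -
  obtain R where R: "\<And>x y. \<bar>x - y\<bar> > R \<Longrightarrow> H x y > 0" using coercive by blast
  obtain M where "M \<ge> 0" "\<And>x y. \<bar>x - y\<bar> \<le> R \<Longrightarrow> \<bar>H x y\<bar> \<le> M" using strip_bounded by blast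
  hence "- M \<le> H x y" for x y using R[of x y] by (smt (verit, ccfv_threshold))
  thus ?thesis by blast
qed

end

section \<open>Existence and uniqueness of the weak KAM constant\<close>

definition lax_oleinik :: "(real \<Rightarrow> real \<Rightarrow> real) \<Rightarrow> (real \<Rightarrow> real) \<Rightarrow> real \<Rightarrow> real" where
  "lax_oleinik H u x = (INF y. u y + H y x)"

definition kam_solution :: "(real \<Rightarrow> real \<Rightarrow> real) \<Rightarrow> real \<Rightarrow> (real \<Rightarrow> real) \<Rightarrow> bool" where
  "kam_solution H s u \<longleftrightarrow> continuous_on UNIV u \<and> (\<forall>x. u (x + 1) = u x) \<and>
     (\<forall>x. u x = lax_oleinik H u x - s)"

definition bounded_periodic :: "(real \<Rightarrow> real) \<Rightarrow> bool" where
  "bounded_periodic u \<longleftrightarrow> bounded (range u) \<and> (\<forall>x. u (x + 1) = u x)"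

lemma bounded_periodicI:
  assumes "\<And>x. \<bar>u x\<bar> \<le> U" "\<And>x. u (x + 1) = u x"
  shows "bounded_periodic u"
  using assms unfolding bounded_periodic_def bounded_iff by auto

lemma bounded_periodicE:
  assumes "bounded_periodic u"
  obtains U where "U \<ge> 0" "\<And>x. \<bar>u x\<bar> \<le> U"
  using assms unfolding bounded_periodic_def bounded_iff by (metis UNIV_I abs_ge_zero image_eqI order_trans real_norm_def)

context twist_kernel
begin

abbreviation "T \<equiv> lax_oleinik H"

lemma lax_bdd_below:
  assumes "bounded_periodic u"
  shows "bdd_below (range (\<lambda>y. u y + H y x))"
proof -
  obtain m U where "\<And>x y. m \<le> H x y" "\<And>x. \<bar>u x\<bar> \<le> U"
    using bounded_below bounded_periodicE[OF assms] by metis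
  hence "m - U \<le> u y + H y x" for y by (smt (verit))
  thus ?thesis by (intro bdd_belowI2) auto
qed

lemma lax_le: "bounded_periodic u \<Longrightarrow> T u x \<le> u y + H y x"
  unfolding lax_oleinik_def by (rule cINF_lower[OF lax_bdd_below]) auto

lemma lax_ge: "(\<And>y. k \<le> u y + H y x) \<Longrightarrow> k \<le> T u x"
  unfolding lax_oleinik_def by (rule cINF_greatest) auto

lemma lax_mono:
  assumes "bounded_periodic u" "\<And>y. u y \<le> v y + k"
  shows "T u x \<le> T v x + k"
proof -
  have "T u x - k \<le> v y + H y x" for y using lax_le[OF assms(1), of x y] assms(2)[of y] by simp
  from lax_ge[of _ v, OF this] show ?thesis by simp
qed

lemma lax_periodic:
  assumes "bounded_periodic u"
  shows "T u (x + 1) = T u x"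
proof (rule antisym)
  have p: "u (y + 1) = u y" for y using assms unfolding bounded_periodic_def by blast
  have "T u (x + 1) \<le> u y + H y x" for y
    using lax_le[OF assms, of "x + 1" "y + 1"] p per by simp
  thus "T u (x + 1) \<le> T u x" by (rule lax_ge)
  have "T u x \<le> u y + H y (x + 1)" for y
    using lax_le[OF assms, of x "y - 1"] p[of "y - 1"] per[of "y - 1" x] by simp
  thus "T u x \<le> T u (x + 1)" by (rule lax_ge)
qed

text \<open>The Lipschitz constant does not depend on \<open>u\<close>: as \<open>u\<close> is periodic, a competitor far from the
diagonal can be replaced by its integer translate near \<open>x'\<close>, which costs less.\<close>

lemma lax_equi_lipschitz:
  "\<exists>L\<ge>0. \<forall>u x x'. bounded_periodic u \<longrightarrow> \<bar>x - x'\<bar> \<le> 1 \<longrightarrow> \<bar>T u x - T u x'\<bar> \<le> L * \<bar>x - x'\<bar>"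
proof -
  obtain M where M: "\<And>x y. \<bar>x - y\<bar> \<le> 1 \<Longrightarrow> \<bar>H x y\<bar> \<le> M" using strip_bounded[of 1] by blast
  obtain R where R: "\<And>x y. \<bar>x - y\<bar> > R \<Longrightarrow> H x y > M" using coercive by blast
  obtain L where L: "L \<ge> 0" "\<And>x y x' y'. \<bar>x - y\<bar> \<le> R + 1 \<Longrightarrow> \<bar>x' - y'\<bar> \<le> R + 1 \<Longrightarrow>
      \<bar>H x y - H x' y'\<bar> \<le> L * (\<bar>x - x'\<bar> + \<bar>y - y'\<bar>)" using strip_lipschitz[of H "R + 1"] by blast
  have "T u x' \<le> T u x + L * \<bar>x - x'\<bar>" if u: "bounded_periodic u" and x: "\<bar>x - x'\<bar> \<le> 1" for u x x'
  proof -
    have "T u x' - L * \<bar>x - x'\<bar> \<le> u y + H y x" for y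
    proof (cases "\<bar>y - x\<bar> \<le> R")
      case True
      have "\<bar>H y x - H y x'\<bar> \<le> L * (\<bar>y - y\<bar> + \<bar>x - x'\<bar>)" by (rule L(2)) (use True x in auto)
      thus ?thesis using lax_le[OF u, of x' y] by simp
    next
      case False
      define y' where "y' = y + of_int \<lfloor>x' - y\<rfloor>"
      have "\<bar>y' - x'\<bar> \<le> 1" unfolding y'_def by linarith
      hence "H y' x' \<le> H y x" using M[of y' x'] R[of y x] False by linarith
      moreover have "u y' = u y" unfolding y'_def
        by (rule periodic_int) (use u bounded_periodic_def in blast)
      moreover have "L * \<bar>x - x'\<bar> \<ge> 0" using L(1) by simp
      ultimately show ?thesis using lax_le[OF u, of x' y'] by linarith
    qed
    from lax_ge[OF this] show ?thesis by simp
  qed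
  note * = this
  have "\<bar>T u x - T u x'\<bar> \<le> L * \<bar>x - x'\<bar>" if "bounded_periodic u" "\<bar>x - x'\<bar> \<le> 1" for u x x'
    using *[of u x x'] *[of u x' x] that by (simp add: abs_le_iff abs_minus_commute[of x' x])
  thus ?thesis using L(1) by blast
qed

lemma lax_oscillation:
  "\<exists>D\<ge>0. \<forall>u x x'. bounded_periodic u \<longrightarrow> \<bar>T u x - T u x'\<bar> \<le> D"
proof -
  obtain L where L: "L \<ge> 0" "\<And>u x x'. bounded_periodic u \<Longrightarrow> \<bar>x - x'\<bar> \<le> 1 \<Longrightarrow> \<bar>T u x - T u x'\<bar> \<le> L * \<bar>x - x'\<bar>"
    using lax_equi_lipschitz by blast
  have "\<bar>T u x - T u x'\<bar> \<le> L" if u: "bounded_periodic u" for u x x'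
  proof -
    define z where "z = x' + of_int \<lfloor>x - x'\<rfloor>"
    have "\<bar>x - z\<bar> \<le> 1" unfolding z_def by linarith
    hence "\<bar>T u x - T u z\<bar> \<le> L * 1" 
      using L(2)[OF u, of x z] mult_left_mono[of "\<bar>x - z\<bar>" 1 L] L(1) by linarith
    moreover have "T u z = T u x'" unfolding z_def by (rule periodic_int) (rule lax_periodic[OF u])
    ultimately show ?thesis by simp
  qed
  thus ?thesis using L(1) by blast
qed

lemma lax_bounded_periodic:
  assumes "bounded_periodic u"
  shows "bounded_periodic (T u)"
proof -
  obtain D where D: "\<And>x x'. \<bar>T u x - T u x'\<bar> \<le> D" using lax_oscillation assms by blast
  have "\<bar>T u x\<bar> \<le> \<bar>T u 0\<bar> + D" for x using D[of x 0] by linarith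
  thus ?thesis by (rule bounded_periodicI) (rule lax_periodic[OF assms])
qed

lemma lax_continuous:
  assumes "bounded_periodic u"
  shows "continuous_on UNIV (T u)"
proof -
  obtain L where L: "\<And>x x'. \<bar>x - x'\<bar> \<le> 1 \<Longrightarrow> \<bar>T u x - T u x'\<bar> \<le> L * \<bar>x - x'\<bar>"
    using lax_equi_lipschitz assms by blast
  have "(T u \<longlongrightarrow> T u x) (at x)" for x
  proof (rule LIM_zero_cancel, rule Lim_null_comparison)
    have "\<forall>\<^sub>F z in at x. dist z x < 1" unfolding eventually_at by (rule exI[of _ 1]) simp
    thus "\<forall>\<^sub>F z in at x. norm (T u z - T u x) \<le> L * \<bar>z - x\<bar>"
      by eventually_elim (use L in \<open>auto simp: dist_real_def\<close>)
    show "((\<lambda>z. L * \<bar>z - x\<bar>) \<longlongrightarrow> 0) (at x)" by (auto intro!: tendsto_eq_intros)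
  qed
  thus ?thesis by (simp add: continuous_on_def)
qed

lemma lax_pow_bounded_periodic:
  "bounded_periodic u \<Longrightarrow> bounded_periodic ((T ^^ n) u)"
  by (induction n) (auto intro: lax_bounded_periodic)

lemma lax_pow_mono:
  assumes "bounded_periodic u" "\<And>y. u y \<le> v y + k"
  shows "(T ^^ n) u x \<le> (T ^^ n) v x + k"
proof (induction n arbitrary: x)
  case (Suc n)
  show ?case using lax_mono[OF lax_pow_bounded_periodic[OF assms(1)] Suc] by simp
qed (use assms in simp)

text \<open>The infimum commutes with this monotone limit because almost optimal competitors stay in a compact
interval, and at their cluster point every \<open>v m\<close> is continuous.\<close>

lemma lax_increasing_limit:
  assumes v: "\<And>n. bounded_periodic (v n)" "\<And>n. continuous_on UNIV (v n)"
    and inc: "\<And>x. incseq (\<lambda>n. v n x)" and lim: "\<And>x. (\<lambda>n. v n x) \<longlonglongrightarrow> u x"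
    and u: "bounded_periodic u" and le: "\<And>n. T (v n) x \<le> a"
  shows "T u x \<le> a"
proof (rule field_le_epsilon)
  fix e :: real assume e: "e > 0"
  obtain U where U: "\<And>x. \<bar>v 0 x\<bar> \<le> U" using bounded_periodicE[OF v(1)] by metis
  obtain R where R: "\<And>x y. \<bar>x - y\<bar> > R \<Longrightarrow> H x y > U + a + e" using coercive by blast
  have "\<exists>y. v n y + H y x < a + e" for n
    using lax_ge[of "a + e" "v n" x] le[of n] e by (meson add_le_same_cancel1 dual_order.trans linorder_not_less)
  then obtain y where y: "\<And>n. v n (y n) + H (y n) x < a + e" by metis
  have "y n \<in> {x - R..x + R}" for n
  proof -
    have "v n (y n) \<ge> - U" using incseqD[OF inc, of 0 n "y n"] U[of "y n"] by linarith
    hence "\<not> \<bar>y n - x\<bar> > R" using R[of "y n" x] y[of n] by linarith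
    thus ?thesis by auto
  qed
  then obtain z r where r: "strict_mono (r :: nat \<Rightarrow> nat)" "(y \<circ> r) \<longlonglongrightarrow> z"
    using compact_Icc[of "x - R" "x + R"] unfolding compact_def by blast
  have "v m z + H z x \<le> a + e" for m
  proof (rule tendsto_upperbound)
    have "continuous_on UNIV (\<lambda>t. v m t + H t x)" by (intro continuous_intros v)
    from continuous_on_tendsto_compose[OF this r(2)]
    show "(\<lambda>n. v m (y (r n)) + H (y (r n)) x) \<longlonglongrightarrow> v m z + H z x" by (simp add: o_def)
    show "\<forall>\<^sub>F n in sequentially. v m (y (r n)) + H (y (r n)) x \<le> a + e"
      unfolding eventually_sequentially
    proof (intro exI[of _ m] allI impI)
      fix n assume "m \<le> n"
      hence "m \<le> r n" using seq_suble[OF r(1), of n] by linarith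
      from incseqD[OF inc this] show "v m (y (r n)) + H (y (r n)) x \<le> a + e"
        using y[of "r n"] by (smt (verit))
    qed
  qed simp
  hence "u z + H z x \<le> a + e"
    by (intro LIMSEQ_le_const2[OF tendsto_add[OF lim tendsto_const]]) blast
  thus "T u x \<le> a + e" using lax_le[OF u, of x z] by linarith
qed

text \<open>The iterates of \<open>0\<close> have oscillation at most \<open>D\<close>, so they are quasi-additive and drift at some
rate \<open>s\<close>.  The infimum \<open>w\<close> of the normalised iterates \<open>T\<^sup>k 0 - k s\<close> is a subsolution.  Iterating the
normalised operator on \<open>w\<close> then gives an increasing bounded sequence whose limit is a fixed
point.\<close>

theorem kam_solution_exists: "\<exists>s u. kam_solution H s u"
proof -
  define a where "a = (\<lambda>n. (T ^^ n) (\<lambda>_. 0))"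
  have zero: "bounded_periodic (\<lambda>_. 0)" by (rule bounded_periodicI[of _ 0]) auto
  have bp: "bounded_periodic (a n)" for n unfolding a_def by (rule lax_pow_bounded_periodic[OF zero])
  obtain D where D: "D \<ge> 0" "\<And>u x x'. bounded_periodic u \<Longrightarrow> \<bar>T u x - T u x'\<bar> \<le> D"
    using lax_oscillation by blast
  have osc: "\<bar>a n x - a n 0\<bar> \<le> D" for n x
    by (cases n) (use D(1) D(2)[OF bp] in \<open>auto simp: a_def\<close>)
  have "\<bar>a (m + n) 0 - a m 0 - a n 0\<bar> \<le> D" for m n
  proof -
    have e: "a (m + n) = (T ^^ m) (a n)" by (simp add: a_def funpow_add)
    have "(T ^^ m) (a n) 0 \<le> (T ^^ m) (\<lambda>_. 0) 0 + (a n 0 + D)"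
      by (rule lax_pow_mono[OF bp]) (use osc in \<open>smt (verit)\<close>)
    moreover have "(T ^^ m) (\<lambda>_. 0) 0 \<le> (T ^^ m) (a n) 0 + (D - a n 0)"
      by (rule lax_pow_mono[OF zero]) (use osc in \<open>smt (verit)\<close>)
    ultimately show ?thesis unfolding e unfolding a_def by linarith
  qed
  then obtain s where s: "\<And>n. \<bar>a n 0 - real n * s\<bar> \<le> D" using quasi_additive_rate[of "\<lambda>n. a n 0" D] by blast
  have as: "\<bar>a n x - real n * s\<bar> \<le> 2 * D" for n x using s[of n] osc[of n x] by linarith
  define w where "w = (\<lambda>x. INF k. a k x - real k * s)"
  have wlow: "w x \<le> a k x - real k * s" for k x unfolding w_def
    by (rule cINF_lower, rule bdd_belowI2[of _ "- 2 * D"]) (use as in \<open>smt (verit)\<close>, simp)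
  have wge: "w x \<ge> b" if "\<And>k. b \<le> a k x - real k * s" for x b
    unfolding w_def by (rule cINF_greatest) (use that in auto)
  have wbd: "\<bar>w x\<bar> \<le> 2 * D" for x
    using wlow[of x 0] wge[of "- 2 * D" x] as by (smt (verit))
  have wper: "w (x + 1) = w x" for x
    using bp unfolding w_def bounded_periodic_def by simp
  have w: "bounded_periodic w" by (rule bounded_periodicI[of w]) (rule wbd wper)+
  have sub: "w x \<le> T w x - s" for x
  proof -
    have "w x + s \<le> w y + H y x" for y
    proof -
      have "w x + s - H y x \<le> a k y - real k * s" for k
        using wlow[of x "Suc k"] lax_le[OF bp, of k x y] by (simp add: a_def algebra_simps)
      from wge[OF this] show ?thesis by simp
    qed
    from lax_ge[OF this] show ?thesis by simp
  qed
  \<comment> \<open>The iterates start at \<open>T w\<close>, which is continuous, whereas \<open>w\<close> is only known to be bounded.\<close>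
  define v where "v = (\<lambda>n x. (T ^^ Suc n) w x - real (Suc n) * s)"
  have vstep: "v (Suc n) x = T (v n) x - s" for n x
  proof -
    have 1: "bounded_periodic ((T ^^ Suc n) w)" by (rule lax_pow_bounded_periodic[OF w])
    have "bounded_periodic (v n)"
    proof -
      obtain U where "\<And>x. \<bar>(T ^^ Suc n) w x\<bar> \<le> U" using bounded_periodicE[OF 1] by metis
      hence "\<bar>v n x\<bar> \<le> U + \<bar>real (Suc n) * s\<bar>" for x unfolding v_def
        using abs_triangle_ineq4 add_right_mono order_trans by blast
      thus ?thesis by (rule bounded_periodicI) (use 1 in \<open>simp add: v_def bounded_periodic_def\<close>)
    qed
    hence "T (v n) x \<le> T ((T ^^ Suc n) w) x + (- (real (Suc n) * s))"
      by (rule lax_mono) (simp add: v_def)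
    moreover have "T ((T ^^ Suc n) w) x \<le> T (v n) x + real (Suc n) * s"
      by (rule lax_mono[OF 1]) (simp add: v_def)
    moreover have "v (Suc n) x = T ((T ^^ Suc n) w) x - real (Suc (Suc n)) * s" unfolding v_def by simp
    ultimately show ?thesis by (simp add: algebra_simps)
  qed
  have inc: "incseq (\<lambda>n. v n x)" for x
  proof (rule incseq_SucI)
    fix n
    have "(T ^^ Suc n) w x \<le> (T ^^ Suc n) (T w) x + (- s)"
      by (rule lax_pow_mono[OF w]) (use sub in \<open>smt (verit)\<close>)
    thus "v n x \<le> v (Suc n) x" unfolding v_def funpow_Suc_right[of "Suc n"]
      by (simp add: algebra_simps)
  qed
  have vbd: "\<bar>v n x\<bar> \<le> 4 * D" for n x
  proof -
    have "(T ^^ Suc n) w x \<le> a (Suc n) x + 2 * D" unfolding a_def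
      by (rule lax_pow_mono[OF w]) (use wbd in \<open>smt (verit)\<close>)
    moreover have "a (Suc n) x \<le> (T ^^ Suc n) w x + 2 * D" unfolding a_def
      by (rule lax_pow_mono[OF zero]) (use wbd in \<open>smt (verit)\<close>)
    ultimately show ?thesis using as[of "Suc n" x] unfolding v_def by linarith
  qed
  have vper: "v n (x + 1) = v n x" for n x
    using lax_pow_bounded_periodic[OF w, of "Suc n"] unfolding v_def bounded_periodic_def by simp
  have vbp: "bounded_periodic (v n)" for n by (rule bounded_periodicI[of "v n"]) (rule vbd vper)+
  have vcont: "continuous_on UNIV (v n)" for n
    using lax_continuous[OF lax_pow_bounded_periodic[OF w, of n]]
    unfolding v_def by (intro continuous_on_diff continuous_on_const) simp
  define u where "u = (\<lambda>x. SUP n. v n x)"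
  have bdd: "bdd_above (range (\<lambda>n. v n x))" for x
    by (rule bdd_aboveI2[of _ _ "4 * D"]) (use vbd in \<open>smt (verit)\<close>)
  have lim: "(\<lambda>n. v n x) \<longlonglongrightarrow> u x" for x
    unfolding u_def by (rule LIMSEQ_incseq_SUP[OF bdd inc])
  have vu: "v n x \<le> u x" for n x unfolding u_def by (rule cSUP_upper[OF _ bdd]) simp
  have ubp: "bounded_periodic u"
  proof (rule bounded_periodicI)
    show "\<bar>u x\<bar> \<le> 4 * D" for x
      by (rule LIMSEQ_le_const2[OF tendsto_rabs[OF lim]]) (use vbd in blast)
    show "u (x + 1) = u x" for x unfolding u_def vper ..
  qed
  have up: "T u x \<le> u x + s" for x
  proof (rule lax_increasing_limit[OF vbp vcont inc lim ubp])
    show "T (v n) x \<le> u x + s" for n using vu[of "Suc n" x] vstep[of n x] by linarith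
  qed
  have lo: "u x \<le> T u x - s" for x
  proof (rule LIMSEQ_le_const2[OF LIMSEQ_Suc[OF lim]], intro exI allI impI)
    fix n
    have "T (v n) x \<le> T u x + 0" by (rule lax_mono[OF vbp]) (use vu in simp)
    thus "v (Suc n) x \<le> T u x - s" unfolding vstep by simp
  qed
  have eq: "u x = T u x - s" for x using up[of x] lo[of x] by linarith
  have "continuous_on UNIV (\<lambda>x. T u x - s)" by (intro continuous_intros lax_continuous ubp)
  moreover have "(\<lambda>x. T u x - s) = u" by (rule ext) (rule eq[symmetric])
  ultimately have "continuous_on UNIV u" by (rule back_subst[of "continuous_on UNIV"])
  moreover have "u (x + 1) = u x" for x using ubp unfolding bounded_periodic_def by blast
  ultimately have "kam_solution H s u" unfolding kam_solution_def using eq by (intro conjI allI)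
  thus ?thesis by blast
qed

lemma kam_solution_bounded_periodic:
  assumes "kam_solution H s u"
  shows "bounded_periodic u"
proof -
  have "\<And>x. u (x + 1) = u x" "continuous_on UNIV u" using assms unfolding kam_solution_def by auto
  thus ?thesis by (metis periodic_continuous_bounded bounded_periodicI)
qed

text \<open>If \<open>M\<close> is the supremum of \<open>u - u'\<close>, monotonicity of the operator gives \<open>M \<le> M + s' - s\<close>.\<close>

theorem kam_constant_unique:
  assumes "kam_solution H s u" "kam_solution H s' u'"
  shows "s = s'"
proof -
  have *: "s \<le> s'" if "kam_solution H s u" "kam_solution H s' u'" for s s' u u'
  proof -
    have bp: "bounded_periodic u" "bounded_periodic u'" using that kam_solution_bounded_periodic by auto
    obtain U U' where U: "\<And>x. \<bar>u x\<bar> \<le> U" "\<And>x. \<bar>u' x\<bar> \<le> U'"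
      using bp bounded_periodicE by metis
    define M where "M = (SUP x. u x - u' x)"
    have "bdd_above (range (\<lambda>x. u x - u' x))"
      by (rule bdd_aboveI2[of _ _ "U + U'"]) (use U in \<open>smt (verit)\<close>)
    hence M: "u x - u' x \<le> M" for x unfolding M_def by (rule cSUP_upper[OF UNIV_I])
    have "u x - u' x \<le> M + s' - s" for x
    proof -
      have "T u x \<le> T u' x + M" by (rule lax_mono[OF bp(1)]) (use M in \<open>smt (verit)\<close>)
      moreover have "u x = T u x - s" "u' x = T u' x - s'" using that unfolding kam_solution_def by blast+
      ultimately show ?thesis by linarith
    qed
    hence "M \<le> M + s' - s" unfolding M_def by (intro cSUP_least) auto
    thus ?thesis by simp
  qed
  show ?thesis using *[OF assms] *[OF assms(2,1)] by simp
qed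

end

text \<open>The difference of the two bounds has a minimum at the contact point, so their derivatives agree there and
squeeze the difference quotients in between.\<close>

lemma has_derivative_between:
  fixes g :: "real \<Rightarrow> real"
  assumes l: "(l has_real_derivative D) (at x)" and h: "(h has_real_derivative D') (at x)"
    and le: "\<And>t. l t \<le> g t" "\<And>t. g t \<le> h t" and eq: "l x = g x" "g x = h x"
  shows "D = D' \<and> (g has_real_derivative D) (at x)"
proof
  have "((\<lambda>t. h t - l t) has_real_derivative D' - D) (at x)" by (intro derivative_intros l h)
  hence "D' - D = 0"
    by (rule DERIV_local_min[where d = 1]) (use le eq in \<open>auto intro: order_trans\<close>)
  thus D: "D = D'" by simp
  have nl: "((\<lambda>t. (l t - l x) / (t - x) - D) \<longlongrightarrow> 0) (at x)" "((\<lambda>t. (h t - h x) / (t - x) - D) \<longlongrightarrow> 0) (at x)"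
    using l h D unfolding has_field_derivative_iff by (auto simp: LIM_zero_iff)
  have "((\<lambda>t. (g t - g x) / (t - x) - D) \<longlongrightarrow> 0) (at x)"
  proof (rule Lim_null_comparison)
    show "((\<lambda>t. \<bar>(l t - l x) / (t - x) - D\<bar> + \<bar>(h t - h x) / (t - x) - D\<bar>) \<longlongrightarrow> 0) (at x)"
      using tendsto_add[OF tendsto_rabs_zero[OF nl(1)] tendsto_rabs_zero[OF nl(2)]] by simp
    have "norm ((g t - g x) / (t - x) - D) \<le> \<bar>(l t - l x) / (t - x) - D\<bar> + \<bar>(h t - h x) / (t - x) - D\<bar>" for t
    proof -
      have a: "l t - l x \<le> g t - g x" "g t - g x \<le> h t - h x" using le eq by auto
      show ?thesis
      proof (cases "t \<ge> x")
        case True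
        hence "(l t - l x) / (t - x) \<le> (g t - g x) / (t - x)" "(g t - g x) / (t - x) \<le> (h t - h x) / (t - x)"
          using a by (auto intro!: divide_right_mono)
        thus ?thesis by auto
      next
        case False
        hence "(l t - l x) / (t - x) \<ge> (g t - g x) / (t - x)" "(g t - g x) / (t - x) \<ge> (h t - h x) / (t - x)"
          using a by (auto intro!: divide_right_mono_neg)
        thus ?thesis by auto
      qed
    qed
    thus "\<forall>\<^sub>F t in at x. norm ((g t - g x) / (t - x) - D) \<le> \<bar>(l t - l x) / (t - x) - D\<bar> + \<bar>(h t - h x) / (t - x) - D\<bar>"
      by simp
  qed
  thus "(g has_real_derivative D) (at x)" unfolding has_field_derivative_iff by (simp add: LIM_zero_iff)
qed

section \<open>The forward map of a weak KAM solution\<close>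

locale weak_kam = twist_kernel +
  fixes s :: real and u :: "real \<Rightarrow> real"
  assumes solution: "kam_solution H s u"
begin

lemma continuous_u [continuous_intros]: "continuous_on A f \<Longrightarrow> continuous_on A (\<lambda>x. u (f x))"
  using solution continuous_on_compose2[of UNIV u A f] unfolding kam_solution_def by auto

lemma u_per: "u (x + 1) = u x"
  using solution unfolding kam_solution_def by blast

lemma u_bounded: obtains U where "U \<ge> 0" "\<And>x. \<bar>u x\<bar> \<le> U"
  using bounded_periodicE[OF kam_solution_bounded_periodic[OF solution]] by blast

text \<open>A pair of defect \<open>0\<close> is called calibrated: \<open>x\<close> realises the minimum that equals \<open>u y + s\<close>.\<close>

definition defect :: "real \<Rightarrow> real \<Rightarrow> real" where
  "defect x y = u x + H x y - s - u y"

definition maximizer :: "real \<Rightarrow> real \<Rightarrow> bool" where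
  "maximizer x y \<longleftrightarrow> (\<forall>y'. u y' - H x y' \<le> u y - H x y)"

lemma u_fixed: "u y + s = T u y"
  using solution unfolding kam_solution_def by (metis diff_add_cancel)

lemma defect_nonneg: "defect x y \<ge> 0"
  using lax_le[OF kam_solution_bounded_periodic[OF solution], of y x] u_fixed[of y]
  unfolding defect_def by linarith

lemma defect_per: "defect (x + 1) (y + 1) = defect x y"
  unfolding defect_def by (simp add: u_per per)

lemma continuous_defect: "continuous_on A (\<lambda>z. defect (fst z) (snd z))"
  unfolding defect_def by (intro continuous_intros)

lemma defect_0_imp_maximizer: "defect x y = 0 \<Longrightarrow> maximizer x y"
  using defect_nonneg[of x] unfolding defect_def maximizer_def by (smt (verit))

text \<open>By coercivity a single radius serves almost calibrated pairs and maximising pairs alike.\<close>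

lemma localized:
  "\<exists>R>0. (\<forall>x y. defect x y \<le> 1 \<longrightarrow> \<bar>x - y\<bar> \<le> R) \<and> (\<forall>x y. maximizer x y \<longrightarrow> \<bar>x - y\<bar> \<le> R) \<and>
     (\<forall>x y. \<bar>x - y\<bar> > R \<longrightarrow> u y - H x y < u x - H x x)"
proof -
  obtain U where U: "U \<ge> 0" "\<And>x. \<bar>u x\<bar> \<le> U" using u_bounded by blast
  obtain M where M: "M \<ge> 0" "\<And>x. \<bar>H x x\<bar> \<le> M" using strip_bounded[of 0] by auto
  obtain R where R: "R > 0" "\<And>x y. \<bar>x - y\<bar> > R \<Longrightarrow> H x y > 2 * U + M + \<bar>s\<bar> + 1" using coercive by blast
  have far: "u y - H x y < u x - H x x" "defect x y > 1" if "\<bar>x - y\<bar> > R" for x y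
    using R(2)[OF that] U(2)[of x] U(2)[of y] M(2)[of x] M(1) unfolding defect_def by linarith+
  hence "\<bar>x - y\<bar> \<le> R" if "maximizer x y" for x y
    using that unfolding maximizer_def by (meson linorder_not_le)
  thus ?thesis using far R(1) by (meson linorder_not_le)
qed

lemma ex_calibrated: "\<exists>x. defect x y = 0"
proof -
  obtain R where R: "R > 0" "\<And>x y. defect x y \<le> 1 \<Longrightarrow> \<bar>x - y\<bar> \<le> R" using localized by blast
  have "continuous_on {y - R..y + R} (\<lambda>x. defect x y)"
    using continuous_on_compose2[OF continuous_defect[of UNIV], of _ "\<lambda>x. (x, y)"] by (simp add: continuous_intros)
  moreover have "{y - R..y + R} \<noteq> {}" using R(1) by simp
  ultimately obtain x where x: "\<And>x'. x' \<in> {y - R..y + R} \<Longrightarrow> defect x y \<le> defect x' y"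
    using continuous_attains_inf[OF compact_Icc] by blast
  define m where "m = min (defect x y) 1"
  have m: "m \<le> defect x' y" for x'
    using x[of x'] R(2)[of x' y] unfolding m_def by (cases "defect x' y \<le> 1") (auto simp: abs_le_iff)
  have "u y + s + m \<le> u x' + H x' y" for x' using m[of x'] unfolding defect_def by linarith
  from lax_ge[of _ u, OF this] have "m \<le> 0" using u_fixed[of y] by linarith
  thus ?thesis using defect_nonneg[of x y] unfolding m_def by (intro exI[of _ x]) linarith
qed

lemma ex_maximizer: "\<exists>y. maximizer x y"
proof -
  obtain R where R: "R > 0" "\<And>x y. \<bar>x - y\<bar> > R \<Longrightarrow> u y - H x y < u x - H x x" using localized by blast
  have "continuous_on {x - R..x + R} (\<lambda>y. u y - H x y)" by (intro continuous_intros)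
  moreover have "{x - R..x + R} \<noteq> {}" using R(1) by simp
  ultimately obtain y where y: "\<And>y'. y' \<in> {x - R..x + R} \<Longrightarrow> u y' - H x y' \<le> u y - H x y"
    using continuous_attains_sup[OF compact_Icc] by blast
  have "u y' - H x y' \<le> u y - H x y" for y'
  proof (cases "y' \<in> {x - R..x + R}")
    case False
    hence "\<bar>x - y'\<bar> > R" by auto
    thus ?thesis using R(2)[of x y'] y[of x] R(1) by auto
  qed (rule y)
  thus ?thesis unfolding maximizer_def by blast
qed

lemma maximizer_mono:
  assumes "maximizer x y" "maximizer x' y'" "y < y'"
  shows "x \<le> x'"
proof (rule ccontr)
  assume "\<not> x \<le> x'"
  hence "0 < \<epsilon> * (x - x') * (y' - y)" using eps assms(3) by simp
  with \<open>\<not> x \<le> x'\<close> have "H x y' + H x' y < H x y + H x' y'"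
    using rect[of x' x y y'] assms(3) by linarith
  moreover have "u y' - H x y' \<le> u y - H x y" "u y - H x' y \<le> u y' - H x' y'"
    using assms unfolding maximizer_def by auto
  ultimately show False by linarith
qed

text \<open>At the middle point of two consecutive calibrated pairs \<open>u\<close> is touched from below through the second pair
and from above through the first one.  The equality of the two derivatives says that calibrated
sequences are orbits of the twist map.\<close>

lemma calibrated_smooth:
  assumes "defect z x = 0" "defect x y = 0"
  shows "- h1 x y = h2 z x" and "(u has_real_derivative - h1 x y) (at x)"
proof -
  let ?l = "\<lambda>t. u y + s - H t y" and ?h = "\<lambda>t. u z + H z t - s"
  have "(?l has_real_derivative - h1 x y) (at x)" "(?h has_real_derivative h2 z x) (at x)"
    by (auto intro!: derivative_eq_intros DERIV1 DERIV2)
  moreover have "?l t \<le> u t" "u t \<le> ?h t" for t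
    using defect_nonneg[of t y] defect_nonneg[of z t] unfolding defect_def by linarith+
  moreover have "?l x = u x" "u x = ?h x" using assms unfolding defect_def by linarith+
  ultimately have "- h1 x y = h2 z x \<and> (u has_real_derivative - h1 x y) (at x)"
    by (rule has_derivative_between)
  thus "- h1 x y = h2 z x" and "(u has_real_derivative - h1 x y) (at x)" by blast+
qed

text \<open>Two calibrated pairs do not cross by the rectangle inequality.  They do not share their first point
either, since \<open>u'\<close> at that point would determine the second one by the twist.\<close>

lemma calibrated_less:
  assumes "defect x y = 0" "defect x' y' = 0" "y < y'"
  shows "x < x'"
proof -
  have "x \<le> x'" by (rule maximizer_mono[OF _ _ assms(3)]) (use assms defect_0_imp_maximizer in auto)
  moreover have "x \<noteq> x'"
  proof
    assume [simp]: "x = x'"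
    obtain z where z: "defect z x = 0" using ex_calibrated by blast
    have "- h1 x y = h2 z x" "- h1 x y' = h2 z x"
      by (rule calibrated_smooth(1)[OF z]; use assms in simp)+
    hence "h1 x y = h1 x y'" by simp
    thus False using h1_twist[of y y' x] assms(3) mult_pos_pos[OF eps, of "y' - y"] by simp
  qed
  ultimately show ?thesis by simp
qed

lemma calibrated_limit:
  assumes "yn \<longlonglongrightarrow> y" "\<And>n. defect (xn n) (yn n) = 0" "closed C" "\<And>n. xn n \<in> C"
  shows "\<exists>a\<in>C. defect a y = 0"
proof -
  obtain R where R: "R > 0" "\<And>x y. defect x y \<le> 1 \<Longrightarrow> \<bar>x - y\<bar> \<le> R" using localized by blast
  obtain B where B: "\<And>n. \<bar>yn n\<bar> \<le> B"
    using Bseq_eq_bounded[THEN iffD1, OF convergent_imp_Bseq[OF convergentI[OF assms(1)]]]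
    unfolding bounded_iff by auto
  have "xn n \<in> {- (B + R)..B + R}" for n
    using R(2)[of "xn n" "yn n"] assms(2)[of n] B[of n] by auto
  then obtain a r where r: "strict_mono (r :: nat \<Rightarrow> nat)" "(xn \<circ> r) \<longlonglongrightarrow> a"
    using compact_Icc[of "- (B + R)" "B + R"] unfolding compact_def by blast
  have "a \<in> C" using closed_sequentially[OF assms(3) _ r(2)] assms(4) by simp
  moreover have "(\<lambda>n. (xn (r n), yn (r n))) \<longlonglongrightarrow> (a, y)"
    using r LIMSEQ_subseq_LIMSEQ[OF assms(1) r(1)] by (intro tendsto_Pair) (auto simp: o_def)
  from continuous_on_tendsto_compose[OF continuous_defect[of UNIV] this]
  have "(\<lambda>n. defect (xn (r n)) (yn (r n))) \<longlonglongrightarrow> defect a y" by simp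
  hence "defect a y = 0" using assms(2) LIMSEQ_unique[OF tendsto_const] by fastforce
  ultimately show ?thesis by blast
qed

text \<open>A calibrated pair \<open>(a', y')\<close> is maximising, so \<open>x \<le> a'\<close> as soon as \<open>y < y'\<close>; now let \<open>y'\<close> tend to
\<open>y\<close>.  Thus \<open>x\<close> lies between two calibrated predecessors of \<open>y\<close>.\<close>

lemma maximizer_between_calibrated:
  assumes "maximizer x y"
  shows "\<exists>a\<ge>x. defect a y = 0" and "\<exists>b\<le>x. defect b y = 0"
proof -
  obtain pre where pre: "\<And>t. defect (pre t) t = 0" using ex_calibrated by metis
  have "(\<lambda>n. y + inverse (real (Suc n))) \<longlonglongrightarrow> y + 0" "(\<lambda>n. y - inverse (real (Suc n))) \<longlonglongrightarrow> y - 0"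
    by (intro tendsto_intros LIMSEQ_inverse_real_of_nat)+
  hence lim: "(\<lambda>n. y + inverse (real (Suc n))) \<longlonglongrightarrow> y" "(\<lambda>n. y - inverse (real (Suc n))) \<longlonglongrightarrow> y" by simp_all
  have "pre (y + inverse (real (Suc n))) \<in> {x..}" "pre (y - inverse (real (Suc n))) \<in> {..x}" for n
    using maximizer_mono[OF assms defect_0_imp_maximizer[OF pre]]
      maximizer_mono[OF defect_0_imp_maximizer[OF pre] assms] by simp_all
  with calibrated_limit[OF lim(1) pre closed_atLeast] calibrated_limit[OF lim(2) pre closed_atMost]
  show "\<exists>a\<ge>x. defect a y = 0" "\<exists>b\<le>x. defect b y = 0" by blast+
qed

text \<open>The intervals spanned by the calibrated predecessors of distinct points are disjoint, so \<open>x\<close> belongs to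
only one of them.\<close>

lemma maximizer_unique:
  assumes "maximizer x y" "maximizer x y'"
  shows "y = y'"
proof -
  have False if yy: "maximizer x y" "maximizer x y'" "y < y'" for y y'
  proof -
    obtain a b where "a \<ge> x" "b \<le> x" "defect a y = 0" "defect b y' = 0"
      using maximizer_between_calibrated yy by metis
    thus False using calibrated_less[of a y b y'] yy(3) by simp
  qed
  thus ?thesis using assms by (metis linorder_neqE)
qed

text \<open>First component of \<open>\<Lambda>\<^sub>c\<close>, as a map of the line.\<close>

definition g :: "real \<Rightarrow> real" where
  "g x = (THE y. maximizer x y)"

lemma maximizer_iff: "maximizer x y \<longleftrightarrow> y = g x"
  unfolding g_def using ex_maximizer maximizer_unique by (metis theI)

lemma calibrated_imp_g: "defect x y = 0 \<Longrightarrow> y = g x"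
  using defect_0_imp_maximizer maximizer_iff by blast

lemma maximizer_per: "maximizer x y \<Longrightarrow> maximizer (x + 1) (y + 1)"
  unfolding maximizer_def using u_per per by (metis diff_add_cancel)

lemma g_per: "g (x + 1) = g x + 1"
  using maximizer_per maximizer_iff by metis

lemma g_mono: "x \<le> x' \<Longrightarrow> g x \<le> g x'"
  using maximizer_mono[of x' "g x'" x "g x"] unfolding maximizer_iff by fastforce

text \<open>For \<open>x < x'\<close> choose calibrated predecessors \<open>a \<ge> x\<close> of \<open>g x\<close> and \<open>b \<le> x'\<close> of \<open>g x'\<close>.  Both are points of
differentiability of \<open>u\<close>; semiconcavity bounds \<open>u' b - u' a\<close> by a multiple of \<open>b - a\<close>, while the
twist makes it at least \<open>\<epsilon> * (g x' - g x)\<close> up to such a multiple.  As \<open>b - a \<le> x' - x\<close>, this gives the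
bound.\<close>

lemma g_lipschitz: "\<exists>L\<ge>0. \<forall>x x'. \<bar>g x - g x'\<bar> \<le> L * \<bar>x - x'\<bar>"
proof -
  obtain R where R: "R > 0" "\<And>x y. defect x y \<le> 1 \<Longrightarrow> \<bar>x - y\<bar> \<le> R" using localized by blast
  obtain K1 where K1: "K1 \<ge> 0" "\<And>x y x' y'. \<bar>x - y\<bar> \<le> R + 1 \<Longrightarrow> \<bar>x' - y'\<bar> \<le> R + 1 \<Longrightarrow>
      \<bar>h1 x y - h1 x' y'\<bar> \<le> K1 * (\<bar>x - x'\<bar> + \<bar>y - y'\<bar>)" using strip_lipschitz[of h1 "R + 1"] by blast
  obtain K2 where K2: "K2 \<ge> 0" "\<And>x y x' y'. \<bar>x - y\<bar> \<le> R + 1 \<Longrightarrow> \<bar>x' - y'\<bar> \<le> R + 1 \<Longrightarrow>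
      \<bar>h2 x y - h2 x' y'\<bar> \<le> K2 * (\<bar>x - x'\<bar> + \<bar>y - y'\<bar>)" using strip_lipschitz[of h2 "R + 1"] by blast
  \<comment> \<open>The second bound serves points at distance more than \<open>1\<close>, where \<open>g\<close> having degree one suffices.\<close>
  define L where "L = max ((K1 + K2) / \<epsilon>) 2"
  have L: "L \<ge> 2" unfolding L_def by simp
  have near: "g x' - g x \<le> L * (x' - x)" if x: "x < x'" "x' \<le> x + 1" for x x'
  proof (cases "g x < g x'")
    case False
    thus ?thesis using x L by (smt (verit) mult_nonneg_nonneg)
  next
    case True
    define y y' where "y = g x" and "y' = g x'"
    obtain a b where ab: "a \<ge> x" "defect a y = 0" "b \<le> x'" "defect b y' = 0"
      using maximizer_between_calibrated maximizer_iff unfolding y_def y'_def by metis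
    have "a < b" using calibrated_less[OF ab(2,4)] True unfolding y_def y'_def by simp
    obtain za zb where z: "defect za a = 0" "defect zb b = 0" using ex_calibrated by metis
    have "za < zb" using calibrated_less[OF z \<open>a < b\<close>] .
    have n: "\<bar>a - y\<bar> \<le> R" "\<bar>za - a\<bar> \<le> R" using R(2) ab z by auto
    have "h2 zb b \<le> h2 za b"
      using h2_twist[of za zb b] \<open>za < zb\<close> mult_pos_pos[OF eps, of "zb - za"] by linarith
    moreover have "\<bar>h2 za b - h2 za a\<bar> \<le> K2 * (\<bar>za - za\<bar> + \<bar>b - a\<bar>)"
      by (rule K2) (use n ab x \<open>a < b\<close> in linarith)+
    moreover have "\<bar>h1 b y - h1 a y\<bar> \<le> K1 * (\<bar>b - a\<bar> + \<bar>y - y\<bar>)"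
      by (rule K1) (use n ab x \<open>a < b\<close> in linarith)+
    moreover have "h1 b y' \<le> h1 b y - \<epsilon> * (y' - y)"
      by (rule h1_twist) (use True in \<open>simp add: y_def y'_def\<close>)
    ultimately have "\<epsilon> * (y' - y) \<le> (K1 + K2) * (b - a)"
      using calibrated_smooth(1)[OF z(1) ab(2)] calibrated_smooth(1)[OF z(2) ab(4)] \<open>a < b\<close>
      by (simp add: algebra_simps)
    also have "\<dots> \<le> (K1 + K2) * (x' - x)" using ab K1(1) K2(1) by (intro mult_left_mono) auto
    finally have "y' - y \<le> (K1 + K2) / \<epsilon> * (x' - x)" using eps by (simp add: field_simps)
    also have "\<dots> \<le> L * (x' - x)" using x unfolding L_def by (intro mult_right_mono) auto
    finally show ?thesis unfolding y_def y'_def .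
  qed
  have far: "g x' - g x \<le> L * (x' - x)" if x: "x < x'" for x x'
  proof (cases "x' \<le> x + 1")
    case False
    define n where "n = \<lceil>x' - x\<rceil>"
    have "g (x + of_int n) - (x + of_int n) = g x - x"
      by (rule periodic_int[of "\<lambda>x. g x - x"]) (simp add: g_per)
    moreover have "g x' \<le> g (x + of_int n)" by (rule g_mono) (simp add: n_def; linarith)
    moreover have "of_int n \<le> x' - x + 1" unfolding n_def by (rule of_int_ceiling_le_add_one)
    moreover have "x' - x + 1 \<le> 2 * (x' - x)" using False by (simp add: algebra_simps)
    moreover have "2 * (x' - x) \<le> L * (x' - x)" using L x by (intro mult_right_mono) auto
    ultimately show ?thesis by linarith
  qed (use near x in blast)
  have "\<bar>g x - g x'\<bar> \<le> L * \<bar>x - x'\<bar>" for x x'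
    using far[of x x'] far[of x' x] g_mono[of x x'] g_mono[of x' x] by (cases x x' rule: linorder_cases) auto
  thus ?thesis using L by (intro exI[of _ L]) auto
qed

lemma h2_graph_lipschitz: "\<exists>L\<ge>0. \<forall>x x'. \<bar>h2 x (g x) - h2 x' (g x')\<bar> \<le> L * \<bar>x - x'\<bar>"
proof -
  obtain L where L: "L \<ge> 0" "\<And>x x'. \<bar>g x - g x'\<bar> \<le> L * \<bar>x - x'\<bar>" using g_lipschitz by blast
  obtain R where R: "R > 0" "\<And>x y. maximizer x y \<Longrightarrow> \<bar>x - y\<bar> \<le> R" using localized by blast
  obtain K where K: "K \<ge> 0" "\<And>x y x' y'. \<bar>x - y\<bar> \<le> R \<Longrightarrow> \<bar>x' - y'\<bar> \<le> R \<Longrightarrow>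
      \<bar>h2 x y - h2 x' y'\<bar> \<le> K * (\<bar>x - x'\<bar> + \<bar>y - y'\<bar>)" using strip_lipschitz[of h2 R] by blast
  have "\<bar>h2 x (g x) - h2 x' (g x')\<bar> \<le> K * (1 + L) * \<bar>x - x'\<bar>" for x x'
  proof -
    have "\<bar>h2 x (g x) - h2 x' (g x')\<bar> \<le> K * (\<bar>x - x'\<bar> + \<bar>g x - g x'\<bar>)"
      by (rule K(2)) (use R(2) maximizer_iff in auto)
    also have "\<dots> \<le> K * (\<bar>x - x'\<bar> + L * \<bar>x - x'\<bar>)" using L(2) K(1) by (intro mult_left_mono add_left_mono) auto
    finally show ?thesis by (simp add: algebra_simps)
  qed
  thus ?thesis using K(1) L(1) by (intro exI[of _ "K * (1 + L)"]) auto
qed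

text \<open>Up to a constant \<open>H x\<close> is an upper bound of \<open>u\<close> with contact at \<open>g x\<close>.\<close>

lemma maximizer_superdiff: "h2 x (g x) \<in> superdiff u (g x)"
proof -
  let ?y = "g x"
  let ?q = "\<lambda>t. (H x t - H x ?y) / (t - ?y) - h2 x ?y"
  have "(?q \<longlongrightarrow> 0) (at ?y)"
    using DERIV2[of x ?y] unfolding has_field_derivative_iff by (simp add: LIM_zero_iff)
  hence "((\<lambda>t. ereal \<bar>?q t\<bar>) \<longlongrightarrow> ereal 0) (at ?y)" by (intro tendsto_intros tendsto_rabs_zero)
  hence "Limsup (at ?y) (\<lambda>t. ereal \<bar>?q t\<bar>) = ereal 0" by (intro lim_imp_Limsup) auto
  moreover have "Limsup (at ?y) (\<lambda>t. ereal ((u t - u ?y - h2 x ?y * (t - ?y)) / \<bar>t - ?y\<bar>))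
      \<le> Limsup (at ?y) (\<lambda>t. ereal \<bar>?q t\<bar>)"
  proof (rule Limsup_mono)
    have "(u t - u ?y - h2 x ?y * (t - ?y)) / \<bar>t - ?y\<bar> \<le> \<bar>?q t\<bar>" if "t \<noteq> ?y" for t
    proof -
      have "u t - u ?y \<le> H x t - H x ?y" using maximizer_iff[of x ?y] unfolding maximizer_def by (smt (verit))
      hence "(u t - u ?y - h2 x ?y * (t - ?y)) / \<bar>t - ?y\<bar> \<le> (H x t - H x ?y - h2 x ?y * (t - ?y)) / \<bar>t - ?y\<bar>"
        by (intro divide_right_mono) auto
      also have "\<dots> \<le> \<bar>H x t - H x ?y - h2 x ?y * (t - ?y)\<bar> / \<bar>t - ?y\<bar>" by (intro divide_right_mono) auto
      also have "\<dots> = \<bar>?q t\<bar>" using that unfolding abs_divide[symmetric] by (simp add: diff_divide_distrib)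
      finally show ?thesis .
    qed
    thus "\<forall>\<^sub>F t in at ?y. ereal ((u t - u ?y - h2 x ?y * (t - ?y)) / \<bar>t - ?y\<bar>) \<le> ereal \<bar>?q t\<bar>"
      by (auto simp: eventually_at_filter)
  qed
  ultimately show ?thesis unfolding superdiff_def by (simp add: zero_ereal_def)
qed

lemma superdiff_nonempty: "superdiff u y \<noteq> {}"
  using maximizer_superdiff ex_calibrated[of y] calibrated_imp_g by force

text \<open>If \<open>u\<close> were differentiable at \<open>g x\<close>, its derivative there would force \<open>x\<close> to be the calibrated
predecessor of \<open>g x\<close>, and \<open>u\<close> is differentiable at such predecessors.\<close>

lemma g_singular:
  assumes "x \<in> Sing u"
  shows "g x \<in> Sing u"
proof (rule ccontr)
  let ?y = "g x"
  assume "?y \<notin> Sing u"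
  then obtain D where D: "(u has_real_derivative D) (at ?y)"
    unfolding Sing_def by (auto simp: real_differentiable_def)
  obtain a where a: "defect a ?y = 0" using ex_calibrated by blast
  have touch: "D = h2 b ?y" if "maximizer b ?y" for b
  proof -
    have "((\<lambda>t. u ?y + H b t - H b ?y) has_real_derivative h2 b ?y) (at ?y)"
      by (auto intro!: derivative_eq_intros DERIV2)
    moreover have "u t \<le> u ?y + H b t - H b ?y" for t
      using that[unfolded maximizer_def, rule_format, of t] by linarith
    ultimately show ?thesis using has_derivative_between[OF D, of _ _ u] by simp
  qed
  have "h2 x ?y = h2 a ?y" using touch maximizer_iff defect_0_imp_maximizer[OF a] by metis
  hence "x = a" using h2_twist[of x a ?y] h2_twist[of a x ?y] eps
    by (smt (verit) mult_pos_pos)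
  moreover obtain z where "defect z a = 0" using ex_calibrated by blast
  ultimately have "u differentiable (at x)"
    using calibrated_smooth(2)[of z x ?y] a by (auto simp: real_differentiable_def)
  thus False using assms unfolding Sing_def by simp
qed

end

section \<open>Rotation numbers\<close>

context weak_kam
begin

lemma g_pow_per: "(g ^^ n) (x + 1) = (g ^^ n) x + 1"
  by (induction n) (simp_all add: g_per)

lemma g_pow_mono: "x \<le> x' \<Longrightarrow> (g ^^ n) x \<le> (g ^^ n) x'"
  by (induction n) (simp_all add: g_mono)

text \<open>The bound uniform in \<open>x\<close> and \<open>n\<close> is stronger than the existence of the limit, and determines
\<open>\<rho>\<close> up to \<open>2 / n\<close> from any single orbit of length \<open>n\<close>.\<close>

definition has_rotation_number :: "real \<Rightarrow> bool" where
  "has_rotation_number \<rho> \<longleftrightarrow> (\<forall>n x. \<bar>(g ^^ n) x - x - real n * \<rho>\<bar> \<le> 2)"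

lemma ex_rotation_number: "\<exists>\<rho>. has_rotation_number \<rho>"
proof -
  have disp: "\<bar>(g ^^ n) x - x - (g ^^ n) 0\<bar> \<le> 1" for n x
  proof -
    define k where "k = \<lfloor>x\<rfloor>"
    have shift: "(g ^^ n) (0 + of_int j) - (0 + of_int j) = (g ^^ n) 0 - 0" for j
      by (rule periodic_int[of "\<lambda>x. (g ^^ n) x - x"]) (simp add: g_pow_per)
    have k: "of_int k \<le> x" "x \<le> of_int (k + 1)" unfolding k_def by linarith+
    show ?thesis using g_pow_mono[OF k(1), of n] g_pow_mono[OF k(2), of n] shift[of k] shift[of "k + 1"] k
      by (simp add: abs_le_iff)
  qed
  have "\<bar>(g ^^ (m + n)) 0 - (g ^^ m) 0 - (g ^^ n) 0\<bar> \<le> 1" for m n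
    using disp[of m "(g ^^ n) 0"] by (simp add: funpow_add algebra_simps)
  then obtain \<rho> where \<rho>: "\<And>n. \<bar>(g ^^ n) 0 - real n * \<rho>\<bar> \<le> 1"
    using quasi_additive_rate[of "\<lambda>n. (g ^^ n) 0" 1] by blast
  have "\<bar>(g ^^ n) x - x - real n * \<rho>\<bar> \<le> 2" for n x using disp[of n x] \<rho>[of n] by linarith
  thus ?thesis unfolding has_rotation_number_def by blast
qed

lemma has_rotation_number_tendsto:
  assumes "has_rotation_number \<rho>"
  shows "(\<lambda>n. 1 / real n * ((g ^^ n) x - x)) \<longlonglongrightarrow> \<rho>"
proof (rule LIM_zero_cancel, rule Lim_null_comparison)
  show "(\<lambda>n. 2 * inverse (real n)) \<longlonglongrightarrow> 0"
    by (rule tendsto_mult_right_zero) (rule lim_inverse_n)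
  show "\<forall>\<^sub>F n in sequentially. norm (1 / real n * ((g ^^ n) x - x) - \<rho>) \<le> 2 * inverse (real n)"
    using eventually_gt_at_top[of 0]
  proof eventually_elim
    case (elim n)
    have "1 / real n * ((g ^^ n) x - x) - \<rho> = ((g ^^ n) x - x - real n * \<rho>) / real n"
      using elim by (simp add: field_simps)
    also have "norm \<dots> \<le> 2 / real n" unfolding real_norm_def abs_divide
      using assms[unfolded has_rotation_number_def, rule_format, of n x] by (simp add: divide_right_mono)
    finally show ?case by (simp add: divide_inverse)
  qed
qed

text \<open>Calibrated predecessors extend an orbit backwards, so the starting point depends on the length \<open>n\<close>.\<close>

lemma ex_calibrated_orbit: "\<exists>x. \<forall>i<n. defect ((g ^^ i) x) ((g ^^ Suc i) x) = 0"
proof (induction n)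
  case (Suc n)
  then obtain x where x: "\<And>i. i < n \<Longrightarrow> defect ((g ^^ i) x) ((g ^^ Suc i) x) = 0" by blast
  obtain x' where x': "defect x' x = 0" using ex_calibrated by blast
  hence gx: "g x' = x" using calibrated_imp_g by simp
  have pow: "(g ^^ Suc i) x' = (g ^^ i) x" for i unfolding funpow_Suc_right by (simp add: gx)
  have "defect ((g ^^ i) x') ((g ^^ Suc i) x') = 0" if "i < Suc n" for i
  proof (cases i)
    case 0
    thus ?thesis using x' gx by simp
  next
    case (Suc j)
    thus ?thesis using x[of j] that unfolding Suc pow by simp
  qed
  thus ?case by blast
qed simp

lemma defect_sum:
  "(\<Sum>i<n. defect (z i) (z (Suc i))) = u (z 0) - u (z n) + (\<Sum>i<n. H (z i) (z (Suc i))) - real n * s"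
  by (induction n) (simp_all add: defect_def algebra_simps)

text \<open>The defect is positive off the graph of \<open>g\<close>; by periodicity and \<open>localized\<close> it suffices to look at a
compact set of pairs.\<close>

lemma near_calibrated:
  assumes "\<eta> > 0"
  shows "\<exists>\<delta>>0. \<forall>x y. defect x y \<le> \<delta> \<longrightarrow> \<bar>y - g x\<bar> \<le> \<eta>"
proof -
  obtain L where L: "\<And>x x'. \<bar>g x - g x'\<bar> \<le> L * \<bar>x - x'\<bar>" using g_lipschitz by blast
  have cg: "continuous_on A g" for A
    by (rule lipschitz_on_continuous_on[of "max L 0"], rule lipschitz_onI)
       (auto simp: dist_real_def intro!: order_trans[OF L] mult_right_mono)
  obtain R where R: "R > 0" "\<And>x y. defect x y \<le> 1 \<Longrightarrow> \<bar>x - y\<bar> \<le> R" using localized by blast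
  define A where "A = ({0..1} \<times> {- R..R + 1}) \<inter> {z. \<eta> \<le> \<bar>snd z - g (fst z)\<bar>}"
  have "closed {z :: real \<times> real. \<eta> \<le> \<bar>snd z - g (fst z)\<bar>}"
    by (intro closed_Collect_le continuous_intros continuous_on_compose2[OF cg[of UNIV]]) auto
  hence "compact A" unfolding A_def by (intro compact_Int_closed compact_Times compact_Icc)
  have "\<exists>\<delta>>0. \<forall>z\<in>A. \<delta> < defect (fst z) (snd z)"
  proof (cases "A = {}")
    case True
    thus ?thesis by (intro exI[of _ 1]) auto
  next
    case False
    obtain z where z: "z \<in> A" "\<And>w. w \<in> A \<Longrightarrow> defect (fst z) (snd z) \<le> defect (fst w) (snd w)"
      using continuous_attains_inf[OF \<open>compact A\<close> False continuous_defect] by blast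
    have "defect (fst z) (snd z) \<noteq> 0" using calibrated_imp_g[of "fst z" "snd z"] z(1) assms unfolding A_def by auto
    hence "defect (fst z) (snd z) > 0" using defect_nonneg[of "fst z" "snd z"] by linarith
    thus ?thesis using z(2) by (intro exI[of _ "defect (fst z) (snd z) / 2"]) force
  qed
  then obtain \<delta> where \<delta>: "\<delta> > 0" "\<And>z. z \<in> A \<Longrightarrow> \<delta> < defect (fst z) (snd z)" by blast
  have "\<bar>y - g x\<bar> \<le> \<eta>" if d: "defect x y \<le> min \<delta> 1" for x y
  proof (rule ccontr)
    assume far: "\<not> \<bar>y - g x\<bar> \<le> \<eta>"
    define n where "n = - \<lfloor>x\<rfloor>"
    define x' where "x' = x + of_int n"
    define y' where "y' = y + of_int n"
    have dd: "defect x' y' = defect x y" unfolding x'_def y'_def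
      by (rule periodic_int[of "\<lambda>t. defect (x + t) (y + t)" 0, simplified]) (use defect_per in \<open>simp add: add.assoc[symmetric]\<close>)
    have "g x' - x' = g x - x" unfolding x'_def
      by (rule periodic_int[of "\<lambda>x. g x - x"]) (simp add: g_per)
    hence "\<bar>y' - g x'\<bar> = \<bar>y - g x\<bar>" unfolding x'_def y'_def by simp
    moreover have "0 \<le> x'" "x' \<le> 1" unfolding x'_def n_def by (simp; linarith)+
    moreover have "\<bar>x' - y'\<bar> \<le> R" using R(2)[of x' y'] d dd by simp
    ultimately have "(x', y') \<in> A" using far unfolding A_def by auto
    thus False using \<delta>(2)[of "(x', y')"] d dd by simp
  qed
  thus ?thesis using \<delta>(1) by (intro exI[of _ "min \<delta> 1"]) auto
qed

text \<open>As \<open>g\<close> is Lipschitz, the errors of the \<open>n\<close> steps accumulate by a factor that depends on \<open>n\<close> only.\<close>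

lemma pseudo_orbit_shadowed:
  assumes "\<eta> > 0"
  shows "\<exists>\<delta>>0. \<forall>z. (\<forall>i<n. defect (z i) (z (Suc i)) \<le> \<delta>) \<longrightarrow> \<bar>z n - (g ^^ n) (z 0)\<bar> \<le> \<eta>"
  using assms
proof (induction n arbitrary: \<eta>)
  case 0
  thus ?case by (intro exI[of _ 1]) simp
next
  case (Suc n)
  obtain L where L: "L \<ge> 0" "\<And>x x'. \<bar>g x - g x'\<bar> \<le> L * \<bar>x - x'\<bar>" using g_lipschitz by blast
  define \<theta> where "\<theta> = \<eta> / (2 * (L + 1))"
  have \<theta>: "\<theta> > 0" "L * \<theta> \<le> \<eta> / 2" using L(1) Suc.prems unfolding \<theta>_def by (auto simp: field_simps)
  obtain \<delta>1 where \<delta>1: "\<delta>1 > 0" "\<And>z. (\<And>i. i < n \<Longrightarrow> defect (z i) (z (Suc i)) \<le> \<delta>1) \<Longrightarrow> \<bar>z n - (g ^^ n) (z 0)\<bar> \<le> \<theta>"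
    using Suc.IH[OF \<theta>(1)] by blast
  obtain \<delta>2 where \<delta>2: "\<delta>2 > 0" "\<And>x y. defect x y \<le> \<delta>2 \<Longrightarrow> \<bar>y - g x\<bar> \<le> \<eta> / 2"
    using near_calibrated[of "\<eta> / 2"] Suc.prems by auto
  have "\<bar>z (Suc n) - (g ^^ Suc n) (z 0)\<bar> \<le> \<eta>"
    if z: "\<And>i. i < Suc n \<Longrightarrow> defect (z i) (z (Suc i)) \<le> min \<delta>1 \<delta>2" for z :: "nat \<Rightarrow> real"
  proof -
    have "\<bar>z n - (g ^^ n) (z 0)\<bar> \<le> \<theta>" by (rule \<delta>1(2)) (use z in force)
    hence "L * \<bar>z n - (g ^^ n) (z 0)\<bar> \<le> \<eta> / 2" using mult_left_mono[of _ \<theta> L] L(1) \<theta>(2) by fastforce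
    hence "\<bar>g (z n) - g ((g ^^ n) (z 0))\<bar> \<le> \<eta> / 2" using L(2) order_trans by blast
    moreover have "\<bar>z (Suc n) - g (z n)\<bar> \<le> \<eta> / 2" by (rule \<delta>2(2)) (use z[of n] in simp)
    ultimately show ?thesis unfolding funpow.simps o_apply by linarith
  qed
  thus ?case using \<delta>1(1) \<delta>2(1) by (intro exI[of _ "min \<delta>1 \<delta>2"]) auto
qed

text \<open>Along a calibrated orbit of length \<open>n\<close> the action of \<open>H\<close> is \<open>n s\<close> up to a bounded error and the
displacement is \<open>n \<rho>\<close> up to \<open>2\<close>.  The action of \<open>H'\<close> along the same orbit is at least \<open>n s'\<close> up to a
bounded error; divide by \<open>n\<close>.\<close>

lemma rotation_number_subgradient:
  assumes \<rho>: "has_rotation_number \<rho>"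
    and other: "weak_kam H' h1' h2' \<epsilon>' s' u'"
    and H': "\<And>x y. H' x y = H x y + d * (x - y)"
  shows "s' \<le> s - d * \<rho>"
proof -
  interpret K: weak_kam H' h1' h2' \<epsilon>' s' u' by (rule other)
  obtain U where U: "\<And>x. \<bar>u x\<bar> \<le> U" using u_bounded by blast
  obtain U' where U': "\<And>x. \<bar>u' x\<bar> \<le> U'" using K.u_bounded by blast
  define C where "C = 2 * U + 2 * U' + 2 * \<bar>d\<bar>"
  have bound: "real n * (s' - s + d * \<rho>) \<le> C" for n
  proof -
    obtain x where x: "\<And>i. i < n \<Longrightarrow> defect ((g ^^ i) x) ((g ^^ Suc i) x) = 0" using ex_calibrated_orbit by blast
    define z where "z = (\<lambda>i. (g ^^ i) x)"
    have "(\<Sum>i<n. H' (z i) (z (Suc i))) = (\<Sum>i<n. H (z i) (z (Suc i))) + d * (z 0 - z n)"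
      by (induction n) (simp_all add: H' algebra_simps)
    moreover have "(\<Sum>i<n. K.defect (z i) (z (Suc i))) \<ge> 0" by (intro sum_nonneg K.defect_nonneg)
    moreover have "(\<Sum>i<n. defect (z i) (z (Suc i))) = 0" using x unfolding z_def by (intro sum.neutral) auto
    ultimately have "real n * (s' - s) \<le> u' (z 0) - u' (z n) - u (z 0) + u (z n) + d * (z 0 - z n)"
      unfolding K.defect_sum defect_sum by (simp add: algebra_simps)
    moreover have "\<bar>d * (z n - z 0 - real n * \<rho>)\<bar> \<le> \<bar>d\<bar> * 2" unfolding abs_mult
      using \<rho> unfolding has_rotation_number_def z_def by (intro mult_left_mono) auto
    moreover have "d * (z n - z 0 - real n * \<rho>) = - (d * (z 0 - z n)) - real n * (d * \<rho>)" by (simp add: algebra_simps)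
    ultimately show ?thesis
      using U[of "z 0"] U[of "z n"] U'[of "z 0"] U'[of "z n"] unfolding C_def ring_distribs by linarith
  qed
  have "s' - s + d * \<rho> \<le> 0"
  proof (rule ccontr)
    assume "\<not> ?thesis"
    then obtain n where "real n * (s' - s + d * \<rho>) > C" using reals_Archimedean3[of "s' - s + d * \<rho>"] by auto
    thus False using bound[of n] by simp
  qed
  thus ?thesis by simp
qed

text \<open>A calibrated orbit of the perturbed problem has, by the subgradient inequality, an average defect of
at most \<open>\<bar>d\<bar> * \<bar>\<rho>' - \<rho>\<bar>\<close> with respect to \<open>u\<close>, up to a bounded total error.  A long one therefore
contains a block of length \<open>n\<close> with small total defect.  That block follows an orbit of \<open>g\<close>, so \<open>n \<rho>'\<close>
and \<open>n \<rho>\<close> differ by at most \<open>5\<close>: twice the error \<open>2\<close> of the rotation numbers, and \<open>1\<close> for the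
distance to the \<open>g\<close>-orbit.\<close>

lemma rotation_number_stable:
  assumes \<rho>: "has_rotation_number \<rho>" and "e > 0"
  shows "\<exists>\<eta>>0. \<forall>H' h1' h2' \<epsilon>' s' u' d \<rho>'. weak_kam H' h1' h2' \<epsilon>' s' u' \<longrightarrow>
    (\<forall>x y. H' x y = H x y + d * (x - y)) \<longrightarrow> weak_kam.has_rotation_number H' u' \<rho>' \<longrightarrow>
    \<bar>d\<bar> * \<bar>\<rho>' - \<rho>\<bar> \<le> \<eta> \<longrightarrow> \<bar>\<rho>' - \<rho>\<bar> \<le> e"
proof -
  obtain n :: nat where n: "n > 0" "5 / real n < e"
  proof -
    obtain n :: nat where "5 / e < real n" using reals_Archimedean2 by blast
    moreover have "5 / e > 0" using \<open>e > 0\<close> by simp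
    ultimately show ?thesis using that[of n] \<open>e > 0\<close> by (cases n) (auto simp: field_simps)
  qed
  obtain \<delta> where \<delta>: "\<delta> > 0" "\<And>z. (\<And>i. i < n \<Longrightarrow> defect (z i) (z (Suc i)) \<le> \<delta>) \<Longrightarrow> \<bar>z n - (g ^^ n) (z 0)\<bar> \<le> 1"
    using pseudo_orbit_shadowed[of 1 n] by auto
  define \<eta> where "\<eta> = \<delta> / (2 * real n)"
  have close: "\<bar>\<rho>' - \<rho>\<bar> \<le> e"
    if other: "weak_kam H' h1' h2' \<epsilon>' s' u'" and H': "\<And>x y. H' x y = H x y + d * (x - y)"
      and \<rho>': "weak_kam.has_rotation_number H' u' \<rho>'" and small: "\<bar>d\<bar> * \<bar>\<rho>' - \<rho>\<bar> \<le> \<eta>"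
    for H' h1' h2' \<epsilon>' s' u' d \<rho>'
  proof -
    interpret K: weak_kam H' h1' h2' \<epsilon>' s' u' by (rule other)
    obtain U where U: "\<And>x. \<bar>u x\<bar> \<le> U" using u_bounded by blast
    obtain U' where U': "\<And>x. \<bar>u' x\<bar> \<le> U'" using K.u_bounded by blast
    define C where "C = 2 * U + 2 * U' + 2 * \<bar>d\<bar>"
    obtain k :: nat where k: "C < real k * (\<delta> / 2)"
      using reals_Archimedean3[of "\<delta> / 2"] \<delta>(1) by auto
    define N where "N = k * n"
    obtain x where x: "\<And>i. i < N \<Longrightarrow> K.defect ((K.g ^^ i) x) ((K.g ^^ Suc i) x) = 0" using K.ex_calibrated_orbit by blast
    define z where "z = (\<lambda>i. (K.g ^^ i) x)"
    have disp: "\<bar>z (i + j) - z i - real j * \<rho>'\<bar> \<le> 2" for i j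
      using \<rho>' unfolding K.has_rotation_number_def z_def by (simp add: funpow_add add.commute[of i])
    have total: "(\<Sum>i<N. defect (z i) (z (Suc i))) < real k * \<delta>"
    proof -
      have "(\<Sum>i<N. H' (z i) (z (Suc i))) = (\<Sum>i<N. H (z i) (z (Suc i))) + d * (z 0 - z N)"
        by (induction N) (simp_all add: H' algebra_simps)
      moreover have "(\<Sum>i<N. K.defect (z i) (z (Suc i))) = 0" using x unfolding z_def by (intro sum.neutral) auto
      ultimately have "(\<Sum>i<N. defect (z i) (z (Suc i))) =
          u (z 0) - u (z N) + u' (z N) - u' (z 0) + real N * (s' - s) - d * (z 0 - z N)"
        unfolding K.defect_sum defect_sum by (simp add: algebra_simps)
      moreover have "real N * (s' - s) \<le> real N * (- (d * \<rho>))"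
        using rotation_number_subgradient[OF \<rho> other H'] by (intro mult_left_mono) auto
      moreover have "\<bar>d * (z N - z 0 - real N * \<rho>')\<bar> \<le> \<bar>d\<bar> * 2" unfolding abs_mult
        using disp[of 0 N] by (intro mult_left_mono) auto
      moreover have "d * (z N - z 0 - real N * \<rho>') = - (d * (z 0 - z N)) - real N * (d * \<rho>')"
        by (simp add: algebra_simps)
      ultimately have "(\<Sum>i<N. defect (z i) (z (Suc i))) \<le> C + real N * (d * \<rho>' - d * \<rho>)"
        using U[of "z 0"] U[of "z N"] U'[of "z 0"] U'[of "z N"] unfolding C_def ring_distribs by linarith
      also have "\<dots> \<le> C + real N * \<eta>"
      proof (intro add_left_mono mult_left_mono)
        have "d * \<rho>' - d * \<rho> \<le> \<bar>d * (\<rho>' - \<rho>)\<bar>" unfolding right_diff_distrib by (rule abs_ge_self)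
        thus "d * \<rho>' - d * \<rho> \<le> \<eta>" using small unfolding abs_mult by linarith
      qed simp
      also have "real N * \<eta> = real k * (\<delta> / 2)" using n(1) unfolding \<eta>_def N_def by simp
      finally show ?thesis using k by simp
    qed
    have "\<exists>j<k. (\<Sum>i\<in>{j * n..<j * n + n}. defect (z i) (z (Suc i))) \<le> \<delta>"
    proof (rule ccontr)
      assume "\<not> ?thesis"
      hence "(\<Sum>j<k. \<delta>) \<le> (\<Sum>j<k. \<Sum>i\<in>{j * n..<j * n + n}. defect (z i) (z (Suc i)))"
        by (intro sum_mono) (auto simp: not_le intro: less_imp_le)
      thus False using total unfolding sum.nat_group N_def by simp
    qed
    then obtain j where j: "(\<Sum>i\<in>{j * n..<j * n + n}. defect (z i) (z (Suc i))) \<le> \<delta>" by blast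
    have "defect (z (j * n + i)) (z (Suc (j * n + i))) \<le> \<delta>" if "i < n" for i
      using member_le_sum[of "j * n + i" "{j * n..<j * n + n}" "\<lambda>i. defect (z i) (z (Suc i))"]
        that j defect_nonneg by fastforce
    hence "\<bar>z (j * n + n) - (g ^^ n) (z (j * n))\<bar> \<le> 1"
      using \<delta>(2)[of "\<lambda>i. z (j * n + i)"] by simp
    moreover have "\<bar>(g ^^ n) (z (j * n)) - z (j * n) - real n * \<rho>\<bar> \<le> 2"
      using \<rho> unfolding has_rotation_number_def by blast
    ultimately have "\<bar>real n * \<rho>' - real n * \<rho>\<bar> \<le> 5" using disp[of "j * n" n] by linarith
    hence "real n * \<bar>\<rho>' - \<rho>\<bar> \<le> 5" unfolding right_diff_distrib[symmetric] abs_mult by simp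
    hence "\<bar>\<rho>' - \<rho>\<bar> \<le> 5 / real n" using n(1) by (simp add: field_simps)
    thus ?thesis using n(2) by simp
  qed
  show ?thesis
  proof (intro exI[of _ \<eta>] conjI allI impI)
    show "\<eta> > 0" unfolding \<eta>_def using \<delta>(1) n(1) by simp
    fix H' h1' h2' :: "real \<Rightarrow> real \<Rightarrow> real" and \<epsilon>' s' u' d \<rho>'
    assume "weak_kam H' h1' h2' \<epsilon>' s' u'" and H': "\<forall>x y. H' x y = H x y + d * (x - y)"
      and "weak_kam.has_rotation_number H' u' \<rho>'" "\<bar>d\<bar> * \<bar>\<rho>' - \<rho>\<bar> \<le> \<eta>"
    thus "\<bar>\<rho>' - \<rho>\<bar> \<le> e" using close[OF _ H'[rule_format]] by blast
  qed
qed

end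

section \<open>Generating functions as twist kernels\<close>

lemma has_derivative_partials:
  fixes k :: "real \<times> real \<Rightarrow> real"
  assumes "(k has_derivative k') (at (x, y))"
  shows "((\<lambda>t. k (t, y)) has_real_derivative k' (1, 0)) (at x)"
    and "((\<lambda>t. k (x, t)) has_real_derivative k' (0, 1)) (at y)"
proof -
  interpret bounded_linear k' using assms by (rule has_derivative_bounded_linear)
  have "((\<lambda>t. (t, y)) has_derivative (\<lambda>h. (h, 0))) (at x)" "((\<lambda>t. (x, t)) has_derivative (\<lambda>h. (0, h))) (at y)"
    by (auto intro!: derivative_eq_intros)
  from has_derivative_compose[OF this(1) assms] has_derivative_compose[OF this(2) assms]
  have d: "((\<lambda>t. k (t, y)) has_derivative (\<lambda>h. k' (h, 0))) (at x)"
    "((\<lambda>t. k (x, t)) has_derivative (\<lambda>h. k' (0, h))) (at y)" by simp_all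
  have "h *\<^sub>R (1, 0) = (h, 0 :: real)" "h *\<^sub>R (0, 1) = (0 :: real, h)" for h :: real
    by simp_all
  hence lin: "k' (h, 0) = k' (1, 0) * h" "k' (0, h) = k' (0, 1) * h" for h
    by (metis scaleR real_scaleR_def mult.commute)+
  have eq: "(\<lambda>h. k' (h, 0)) = (*) (k' (1, 0))" "(\<lambda>h. k' (0, h)) = (*) (k' (0, 1))"
    by (rule ext, rule lin)+
  from d show "((\<lambda>t. k (t, y)) has_real_derivative k' (1, 0)) (at x)"
    and "((\<lambda>t. k (x, t)) has_real_derivative k' (0, 1)) (at y)"
    unfolding has_field_derivative_def eq by this
qed

lemma C1_DERIV_d1_d2:
  assumes "C1 k"
  shows "((\<lambda>t. k (t, y)) has_real_derivative d1 k (x, y)) (at x)"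
    and "((\<lambda>t. k (x, t)) has_real_derivative d2 k (x, y)) (at y)"
proof -
  obtain k' where "(k has_derivative blinfun_apply k') (at (x, y))" using assms unfolding C1_def by blast
  from has_derivative_partials[OF this]
  show "((\<lambda>t. k (t, y)) has_real_derivative d1 k (x, y)) (at x)"
    and "((\<lambda>t. k (x, t)) has_real_derivative d2 k (x, y)) (at y)"
    unfolding d1_def d2_def by (auto simp: DERIV_imp_deriv)
qed

lemma C2_imp_C1: "C2 k \<Longrightarrow> C1 k"
  unfolding C2_def C1_def
  by (meson continuous_at_imp_continuous_on has_derivative_continuous)

lemma C1_evaluate:
  fixes k :: "'a::real_normed_vector \<Rightarrow> 'b::real_normed_vector \<Rightarrow>\<^sub>L 'c::real_normed_vector"
  assumes "C1 k"
  shows "C1 (\<lambda>z. blinfun_apply (k z) v)"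
proof -
  obtain k' where k': "\<And>z. (k has_derivative blinfun_apply (k' z)) (at z)" "continuous_on UNIV k'"
    using assms unfolding C1_def by blast
  define ev where "ev = Blinfun (\<lambda>f :: 'b \<Rightarrow>\<^sub>L 'c. blinfun_apply f v)"
  have ev: "blinfun_apply ev = (\<lambda>f. blinfun_apply f v)" unfolding ev_def
    by (rule bounded_linear_Blinfun_apply) (rule blinfun.bounded_linear_left)
  have "blinfun_apply (ev o\<^sub>L k' z) = (\<lambda>h. blinfun_apply (blinfun_apply (k' z) h) v)" for z
    by (simp add: fun_eq_iff ev)
  hence "((\<lambda>z. blinfun_apply (k z) v) has_derivative blinfun_apply (ev o\<^sub>L k' z)) (at z)" for z
    using bounded_linear.has_derivative[OF blinfun.bounded_linear_left k'(1)] by metis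
  moreover have "continuous_on UNIV (\<lambda>z. ev o\<^sub>L k' z)"
    by (intro bounded_bilinear.continuous_on[OF bounded_bilinear_blinfun_compose] continuous_on_const k')
  ultimately show ?thesis unfolding C1_def by (intro exI[of _ "\<lambda>z. ev o\<^sub>L k' z"] conjI allI)
qed

lemma C2_imp_C1_d1_d2:
  fixes k :: "real \<times> real \<Rightarrow> real"
  assumes "C2 k"
  shows "C1 (d1 k)" and "C1 (d2 k)"
proof -
  obtain k' where k': "\<And>z. (k has_derivative blinfun_apply (k' z)) (at z)" "C1 k'"
    using assms unfolding C2_def by blast
  have "d1 k = (\<lambda>z. blinfun_apply (k' z) (1, 0))" "d2 k = (\<lambda>z. blinfun_apply (k' z) (0, 1))"
    unfolding d1_def d2_def using has_derivative_partials[OF k'(1)]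
    by (auto intro!: ext DERIV_imp_deriv)
  thus "C1 (d1 k)" "C1 (d2 k)" using C1_evaluate[OF k'(2)] by simp_all
qed

text \<open>The derivative is periodic too, hence bounded on the strip, which is convex.\<close>

lemma C1_periodic_strip_lipschitz:
  fixes k :: "real \<times> real \<Rightarrow> real"
  assumes "C1 k" and per: "\<And>x y. k (x + 1, y + 1) = k (x, y)"
  shows "\<exists>K\<ge>0. \<forall>x y x' y'. \<bar>x - y\<bar> \<le> R \<longrightarrow> \<bar>x' - y'\<bar> \<le> R \<longrightarrow>
           \<bar>k (x, y) - k (x', y')\<bar> \<le> K * (\<bar>x - x'\<bar> + \<bar>y - y'\<bar>)"
proof -
  obtain k' where k': "\<And>z. (k has_derivative blinfun_apply (k' z)) (at z)" "continuous_on UNIV k'"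
    using assms(1) unfolding C1_def by blast
  have k'per: "k' (x + 1, y + 1) = k' (x, y)" for x y
  proof -
    have "((\<lambda>z. z + (1, 1)) has_derivative (\<lambda>h. h)) (at (x, y))" by (auto intro!: derivative_eq_intros)
    from has_derivative_compose[OF this, of k "blinfun_apply (k' (x + 1, y + 1))"]
    have "((\<lambda>z. k (z + (1, 1))) has_derivative blinfun_apply (k' (x + 1, y + 1))) (at (x, y))"
      using k'(1) by simp
    moreover have "(\<lambda>z. k (z + (1, 1))) = k" using per by (auto simp: fun_eq_iff)
    ultimately show ?thesis using has_derivative_unique[OF _ k'(1)] blinfun_apply_inject by fastforce
  qed
  have "compact (k' ` ({0..1} \<times> {- \<bar>R\<bar>..\<bar>R\<bar> + 1}))"
    by (intro compact_continuous_image compact_Times compact_Icc continuous_on_subset[OF k'(2)]) simp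
  then obtain K where K: "K > 0" "\<And>z. z \<in> {0..1} \<times> {- \<bar>R\<bar>..\<bar>R\<bar> + 1} \<Longrightarrow> norm (k' z) \<le> K"
    using compact_imp_bounded bounded_pos by (metis image_eqI)
  define A where "A = (\<lambda>z :: real \<times> real. fst z - snd z) -` {- R..R}"
  have "linear (\<lambda>z :: real \<times> real. fst z - snd z)"
    by (intro linear_compose_sub) (auto simp: linear_fst linear_snd)
  hence "convex A" unfolding A_def by (intro convex_linear_vimage) auto
  have bound: "norm (k' z) \<le> K" if "z \<in> A" for z
  proof -
    obtain x y where z: "z = (x, y)" by (cases z)
    define n where "n = - \<lfloor>x\<rfloor>"
    have "k' (x + of_int n, y + of_int n) = k' (x, y)"
      by (rule periodic_int[of "\<lambda>t. k' (x + t, y + t)" 0, simplified])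
         (use k'per in \<open>simp add: add.assoc[symmetric]\<close>)
    moreover have "0 \<le> x + of_int n" "x + of_int n \<le> 1" unfolding n_def by (simp; linarith)+
    moreover have "\<bar>x - y\<bar> \<le> R" using that unfolding A_def z by auto
    ultimately show ?thesis using K(2)[of "(x + of_int n, y + of_int n)"] unfolding z
      by (simp add: abs_le_iff)
  qed
  have "\<bar>k (x, y) - k (x', y')\<bar> \<le> K * (\<bar>x - x'\<bar> + \<bar>y - y'\<bar>)"
    if "\<bar>x - y\<bar> \<le> R" "\<bar>x' - y'\<bar> \<le> R" for x y x' y'
  proof -
    have "norm (k (x, y) - k (x', y')) \<le> K * norm ((x, y) - (x', y'))"
    proof (rule differentiable_bound[OF \<open>convex A\<close>])
      show "(k has_derivative blinfun_apply (k' z)) (at z within A)" for z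
        using k'(1) by (rule has_derivative_at_withinI)
      show "onorm (blinfun_apply (k' z)) \<le> K" if "z \<in> A" for z
        using bound[OF that] by (simp add: norm_blinfun.rep_eq)
    qed (use that in \<open>auto simp: A_def abs_le_iff\<close>)
    also have "\<dots> \<le> K * (\<bar>x - x'\<bar> + \<bar>y - y'\<bar>)"
      using K(1) norm_Pair_le[of "x - x'" "y - y'"] by (intro mult_left_mono) auto
    finally show ?thesis by simp
  qed
  thus ?thesis using K(1) by (intro exI[of _ K]) auto
qed

lemma strip_lipschitz_add_linear:
  fixes k :: "real \<Rightarrow> real \<Rightarrow> real"
  assumes "\<exists>K\<ge>0. \<forall>x y x' y'. \<bar>x - y\<bar> \<le> R \<longrightarrow> \<bar>x' - y'\<bar> \<le> R \<longrightarrow>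
             \<bar>k x y - k x' y'\<bar> \<le> K * (\<bar>x - x'\<bar> + \<bar>y - y'\<bar>)"
  shows "\<exists>K\<ge>0. \<forall>x y x' y'. \<bar>x - y\<bar> \<le> R \<longrightarrow> \<bar>x' - y'\<bar> \<le> R \<longrightarrow>
           \<bar>(k x y + c * (x - y)) - (k x' y' + c * (x' - y'))\<bar> \<le> K * (\<bar>x - x'\<bar> + \<bar>y - y'\<bar>)"
proof -
  obtain K where K: "K \<ge> 0" "\<And>x y x' y'. \<bar>x - y\<bar> \<le> R \<Longrightarrow> \<bar>x' - y'\<bar> \<le> R \<Longrightarrow>
      \<bar>k x y - k x' y'\<bar> \<le> K * (\<bar>x - x'\<bar> + \<bar>y - y'\<bar>)" using assms by blast
  have "\<bar>(k x y + c * (x - y)) - (k x' y' + c * (x' - y'))\<bar> \<le> (K + \<bar>c\<bar>) * (\<bar>x - x'\<bar> + \<bar>y - y'\<bar>)"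
    if "\<bar>x - y\<bar> \<le> R" "\<bar>x' - y'\<bar> \<le> R" for x y x' y'
  proof -
    have "\<bar>c * (x - y) - c * (x' - y')\<bar> = \<bar>c\<bar> * \<bar>(x - x') - (y - y')\<bar>"
      unfolding abs_mult[symmetric] by (simp add: algebra_simps)
    also have "\<dots> \<le> \<bar>c\<bar> * (\<bar>x - x'\<bar> + \<bar>y - y'\<bar>)" by (intro mult_left_mono) auto
    finally show ?thesis using K(2)[OF that] unfolding distrib_right[of K] by linarith
  qed
  thus ?thesis using K(1) by (intro exI[of _ "K + \<bar>c\<bar>"]) auto
qed

text \<open>The constant \<open>\<epsilon>\<close> is the same for all \<open>c\<close>, since the linear term \<open>c * (x - y)\<close> cancels in the rectangle
inequality.\<close>

lemma generating_function_twist_kernel: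
  assumes "generating_function S F"
  shows "\<exists>\<epsilon>. \<forall>c. twist_kernel (\<lambda>x y. Sc S c (x, y)) (\<lambda>x y. d1 S (x, y) + c) (\<lambda>x y. d2 S (x, y) - c) \<epsilon>"
proof -
  have C2: "C2 S" and per: "\<And>x y. S (x + 1, y + 1) = S (x, y)"
    using assms unfolding generating_function_def by auto
  obtain \<epsilon> where \<epsilon>: "\<epsilon> > 0" "\<And>z. d1 (d2 S) z < - \<epsilon>" using assms unfolding generating_function_def by blast
  note D = C1_DERIV_d1_d2[OF C2_imp_C1[OF C2]]
  note C1d = C2_imp_C1_d1_d2[OF C2]
  have d2_decr: "d2 S (x', t) + \<epsilon> * x' \<le> d2 S (x, t) + \<epsilon> * x" if "x \<le> x'" for x x' t
  proof (rule DERIV_nonpos_imp_nonincreasing[OF that])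
    fix v
    show "\<exists>y. ((\<lambda>v. d2 S (v, t) + \<epsilon> * v) has_real_derivative y) (at v) \<and> y \<le> 0"
      using \<epsilon>(2)[of "(v, t)"]
      by (intro exI[of _ "d1 (d2 S) (v, t) + \<epsilon>"]) (auto intro!: derivative_eq_intros C1_DERIV_d1_d2 C1d)
  qed
  have rect: "S (x', y') + S (x, y) \<le> S (x, y') + S (x', y) - \<epsilon> * (x' - x) * (y' - y)"
    if "x \<le> x'" "y \<le> y'" for x x' y y'
  proof -
    have "S (x', y') - S (x, y') + \<epsilon> * (x' - x) * y' \<le> S (x', y) - S (x, y) + \<epsilon> * (x' - x) * y"
    proof (rule DERIV_nonpos_imp_nonincreasing[OF that(2)])
      fix v
      show "\<exists>l. ((\<lambda>v. S (x', v) - S (x, v) + \<epsilon> * (x' - x) * v) has_real_derivative l) (at v) \<and> l \<le> 0"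
        using d2_decr[OF that(1), of v]
        by (intro exI[of _ "d2 S (x', v) - d2 S (x, v) + \<epsilon> * (x' - x)"])
           (auto intro!: derivative_eq_intros D simp: algebra_simps)
    qed
    thus ?thesis by (simp add: algebra_simps)
  qed
  have d1per: "d1 S (x + 1, y + 1) = d1 S (x, y)" for x y
    using D(1)[of "y + 1" "x + 1"] D(1)[of y x] unfolding DERIV_shift per by (metis DERIV_unique)
  have d2per: "d2 S (x + 1, y + 1) = d2 S (x, y)" for x y
    using D(2)[of "x + 1" "y + 1"] D(2)[of x y] unfolding DERIV_shift per by (metis DERIV_unique)
  have "twist_kernel (\<lambda>x y. Sc S c (x, y)) (\<lambda>x y. d1 S (x, y) + c) (\<lambda>x y. d2 S (x, y) - c) \<epsilon>" for c
  proof
    show "\<epsilon> > 0" by fact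
    show "Sc S c (x + 1, y + 1) = Sc S c (x, y)" for x y unfolding Sc_def by (simp add: per)
    show "((\<lambda>t. Sc S c (t, y)) has_real_derivative d1 S (x, y) + c) (at x)" for x y
      unfolding Sc_def by (auto intro!: derivative_eq_intros D)
    show "((\<lambda>t. Sc S c (x, t)) has_real_derivative d2 S (x, y) - c) (at y)" for x y
      unfolding Sc_def by (auto intro!: derivative_eq_intros D)
    show "Sc S c (x', y') + Sc S c (x, y) \<le> Sc S c (x, y') + Sc S c (x', y) - \<epsilon> * (x' - x) * (y' - y)"
      if "x \<le> x'" "y \<le> y'" for x x' y y'
      using rect[OF that] unfolding Sc_def by (simp add: algebra_simps)
    show "\<exists>K\<ge>0. \<forall>x y x' y'. \<bar>x - y\<bar> \<le> R \<longrightarrow> \<bar>x' - y'\<bar> \<le> R \<longrightarrow>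
          \<bar>k x y - k x' y'\<bar> \<le> K * (\<bar>x - x'\<bar> + \<bar>y - y'\<bar>)"
      if "k \<in> {\<lambda>x y. Sc S c (x, y), \<lambda>x y. d1 S (x, y) + c, \<lambda>x y. d2 S (x, y) - c}" for R k
      using that strip_lipschitz_add_linear[of R "\<lambda>x y. S (x, y)" c]
        C1_periodic_strip_lipschitz[OF C2_imp_C1[OF C2] per, of R]
        C1_periodic_strip_lipschitz[OF C1d(1) d1per, of R] C1_periodic_strip_lipschitz[OF C1d(2) d2per, of R]
      unfolding Sc_def by auto
  qed
  thus ?thesis by blast
qed


section \<open>The derivative of Mather's function\<close>

lemma weak_KAM_eq_iff_kam_solution:
  "weak_KAM_eq S c s u \<longleftrightarrow> kam_solution (\<lambda>x y. Sc S c (x, y)) s u"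
  unfolding weak_KAM_eq_def kam_solution_def Tminus_def lax_oleinik_def ..

lemma weak_KAM_eq_Sbar:
  assumes "generating_function S F"
  shows "\<exists>u. weak_KAM_eq S c (Sbar S c) u"
proof -
  obtain \<epsilon> where "twist_kernel (\<lambda>x y. Sc S c (x, y)) (\<lambda>x y. d1 S (x, y) + c) (\<lambda>x y. d2 S (x, y) - c) \<epsilon>"
    using generating_function_twist_kernel[OF assms] by blast
  then interpret twist_kernel "\<lambda>x y. Sc S c (x, y)" "\<lambda>x y. d1 S (x, y) + c" "\<lambda>x y. d2 S (x, y) - c" \<epsilon> .
  have "\<exists>!s. \<exists>u. weak_KAM_eq S c s u"
    unfolding weak_KAM_eq_iff_kam_solution using kam_solution_exists kam_constant_unique by blast
  thus ?thesis unfolding Sbar_def by (rule theI')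
qed

text \<open>Let \<open>r b\<close> be the rotation number of some solution at class \<open>b\<close>.  The subgradient inequalities at \<open>b\<close> and at \<open>c\<close>
put the difference quotient of \<open>\<alpha>\<close> between \<open>\<rho>\<close> and \<open>r b\<close>, and make \<open>r\<close> monotone, hence
bounded near \<open>c\<close>.  Stability then shows that \<open>r b\<close> tends to \<open>\<rho>\<close> as \<open>b\<close> tends to \<open>c\<close>.\<close>

lemma mather_alpha_has_derivative_rotation_number:
  assumes kernel: "\<And>c. twist_kernel (\<lambda>x y. Sc S c (x, y)) (\<lambda>x y. d1 S (x, y) + c) (\<lambda>x y. d2 S (x, y) - c) \<epsilon>"
    and sol: "\<And>c. \<exists>u. weak_KAM_eq S c (Sbar S c) u"
    and u: "weak_KAM_eq S c (Sbar S c) u"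
    and \<rho>: "weak_kam.has_rotation_number (\<lambda>x y. Sc S c (x, y)) u \<rho>"
  shows "(mather_alpha S has_real_derivative \<rho>) (at c)"
proof -
  define H where "H = (\<lambda>c x y. Sc S c (x, y))"
  define kam where "kam = (\<lambda>c. weak_kam (H c) (\<lambda>x y. d1 S (x, y) + c) (\<lambda>x y. d2 S (x, y) - c) \<epsilon> (Sbar S c))"
  have shift: "H b x y = H a x y + (b - a) * (x - y)" for a b x y
    unfolding H_def Sc_def by (simp add: algebra_simps)
  have kamI: "kam c v" if "weak_KAM_eq S c (Sbar S c) v" for c v
    unfolding kam_def H_def weak_kam_def weak_kam_axioms_def
    using kernel that unfolding weak_KAM_eq_iff_kam_solution by blast
  have "\<exists>v r. kam c v \<and> weak_kam.has_rotation_number (H c) v r" for c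
  proof -
    obtain v where v: "kam c v" using sol[of c] kamI by blast
    from weak_kam.ex_rotation_number[OF v[unfolded kam_def]] v show ?thesis by blast
  qed
  then obtain v r where vr: "\<And>c. kam c (v c)" "\<And>c. weak_kam.has_rotation_number (H c) (v c) (r c)" by metis
  have c: "kam c u" "weak_kam.has_rotation_number (H c) u \<rho>" using kamI[OF u] \<rho> unfolding H_def by auto
  have sub: "Sbar S b \<le> Sbar S a - (b - a) * r a" for a b
    by (rule weak_kam.rotation_number_subgradient[OF vr(1)[unfolded kam_def] vr(2) vr(1)[unfolded kam_def] shift])
  have subc: "Sbar S b \<le> Sbar S c - (b - c) * \<rho>" for b
    by (rule weak_kam.rotation_number_subgradient[OF c(1)[unfolded kam_def] c(2) vr(1)[unfolded kam_def] shift])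
  have mono: "r a \<le> r b" if "a \<le> b" for a b
  proof (cases "a = b")
    case False
    have "(b - a) * r a \<le> (b - a) * r b" using sub[of b a] sub[of a b] by (simp add: algebra_simps)
    thus ?thesis using False that by simp
  qed simp
  define B where "B = \<bar>r (c - 1)\<bar> + \<bar>r (c + 1)\<bar> + \<bar>\<rho>\<bar> + 1"
  show ?thesis unfolding has_field_derivative_iff
  proof (rule LIM_I)
    fix e :: real assume "e > 0"
    hence "e / 2 > 0" by simp
    from weak_kam.rotation_number_stable[OF c(1)[unfolded kam_def] c(2) this]
    obtain \<eta> where \<eta>: "\<eta> > 0" and stab: "\<And>H' h1' h2' \<epsilon>' s' u' d \<rho>'. weak_kam H' h1' h2' \<epsilon>' s' u' \<Longrightarrow>
        \<forall>x y. H' x y = H c x y + d * (x - y) \<Longrightarrow> weak_kam.has_rotation_number H' u' \<rho>' \<Longrightarrow>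
        \<bar>d\<bar> * \<bar>\<rho>' - \<rho>\<bar> \<le> \<eta> \<Longrightarrow> \<bar>\<rho>' - \<rho>\<bar> \<le> e / 2"
      by (elim exE conjE) metis
    have stable: "\<bar>r b - \<rho>\<bar> \<le> e / 2" if "\<bar>b - c\<bar> * \<bar>r b - \<rho>\<bar> \<le> \<eta>" for b
      by (rule stab[OF vr(1)[unfolded kam_def] _ vr(2) that]) (intro allI shift)
    have B: "B > 0" unfolding B_def by simp
    show "\<exists>s>0. \<forall>b. b \<noteq> c \<and> norm (b - c) < s \<longrightarrow> norm ((mather_alpha S b - mather_alpha S c) / (b - c) - \<rho>) < e"
    proof (intro exI[of _ "min 1 (\<eta> / B)"] conjI allI impI)
      fix b assume b: "b \<noteq> c \<and> norm (b - c) < min 1 (\<eta> / B)"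
      have "\<bar>r b - \<rho>\<bar> \<le> B" using mono[of "c - 1" b] mono[of b "c + 1"] b unfolding B_def by (auto simp: abs_less_iff)
      hence "\<bar>b - c\<bar> * \<bar>r b - \<rho>\<bar> \<le> \<eta> / B * B" using b \<eta> B by (intro mult_mono) auto
      hence close: "\<bar>r b - \<rho>\<bar> \<le> e / 2" using stable B by simp
      define q where "q = (mather_alpha S b - mather_alpha S c) / (b - c)"
      have q: "mather_alpha S b - mather_alpha S c = (b - c) * q" unfolding q_def using b by simp
      have 1: "(b - c) * \<rho> \<le> (b - c) * q" "(b - c) * q \<le> (b - c) * r b"
        unfolding q[symmetric] mather_alpha_def using subc[of b] sub[of c b] by (auto simp: algebra_simps)
      have "\<rho> \<le> q \<and> q \<le> r b \<or> r b \<le> q \<and> q \<le> \<rho>"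
      proof (cases "b > c")
        case True
        thus ?thesis using 1 by simp
      next
        case False
        hence "b - c < 0" using b by simp
        thus ?thesis using 1 by (simp add: mult_le_cancel_left_neg)
      qed
      hence "\<bar>q - \<rho>\<bar> \<le> \<bar>r b - \<rho>\<bar>" by linarith
      thus "norm ((mather_alpha S b - mather_alpha S c) / (b - c) - \<rho>) < e"
        using close \<open>e > 0\<close> unfolding q_def by simp
    qed (use \<eta> B in simp)
  qed
qed

section \<open>The map on the pseudo-graph\<close>

lemma superdiff_periodic:
  assumes "\<And>x. u (x + 1) = u x"
  shows "superdiff u x \<subseteq> superdiff u (x + 1)"
proof
  fix p assume "p \<in> superdiff u x"
  let ?q = "\<lambda>x y. ereal ((u y - u x - p * (y - x)) / \<bar>y - x\<bar>)"
  have "?q (x + 1) y = ?q x (y - 1)" for y using assms[of x] assms[of "y - 1"] by (simp add: algebra_simps)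
  hence "Limsup (at (x + 1)) (?q (x + 1)) = Limsup (at (x + 1)) (\<lambda>y. ?q x (y - 1))" by simp
  also have "\<dots> \<le> Limsup (filtermap (\<lambda>y. y - 1) (at (x + 1))) (?q x)" by (rule Limsup_filtermap_ge)
  also have "\<dots> = Limsup (at x) (?q x)" unfolding filtermap_at_shift by simp
  also have "\<dots> \<le> 0" using \<open>p \<in> superdiff u x\<close> unfolding superdiff_def by simp
  finally show "p \<in> superdiff u (x + 1)" unfolding superdiff_def by simp
qed

theorem theorem1p6:
  fixes f :: "complex \<times> real \<Rightarrow> complex \<times> real"
    and F :: "real \<times> real \<Rightarrow> real \<times> real"
    and S :: "real \<times> real \<Rightarrow> real"
    and c :: real
    and u :: "real \<Rightarrow> real"
  assumes "twist_map f"
    and "is_lift F f"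
    and "generating_function S F"
    and "weak_KAM_solution S c u"
  shows "(\<forall>(x, p) \<in> pseudo_graph c u. \<exists>!y. Lam_rel S c u x y)
       \<and> Lam S c u \<in> pseudo_graph c u \<rightarrow> pseudo_graph c u
       \<and> (\<forall>(x, p) \<in> pseudo_graph c u.
            (x + 1, p) \<in> pseudo_graph c u \<and> Lam S c u (x + 1, p) = Lam S c u (x, p) + (1, 0))
       \<and> (\<exists>L. L-lipschitz_on (pseudo_graph c u) (Lam S c u))
       \<and> monotone_on (pseudo_graph c u) pg_le pg_le (Lam S c u)
       \<and> (\<forall>V \<in> vertical_segments c u. \<exists>z. Lam S c u ` V = {z} \<and>
            (\<exists>V' \<in> vertical_segments c u. z \<in> V'))
       \<and> (\<exists>\<rho>. (\<forall>(x, p) \<in> pseudo_graph c u.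
                (\<lambda>n. 1 / real n * (fst ((Lam S c u ^^ n) (x, p)) - x)) \<longlonglongrightarrow> \<rho>)
            \<and> (mather_alpha S has_real_derivative \<rho>) (at c))"
proof -
  let ?G = "pseudo_graph c u" and ?\<Lambda> = "Lam S c u"
  obtain \<epsilon> where kernel: "\<And>c. twist_kernel (\<lambda>x y. Sc S c (x, y)) (\<lambda>x y. d1 S (x, y) + c) (\<lambda>x y. d2 S (x, y) - c) \<epsilon>"
    using generating_function_twist_kernel[OF assms(3)] by blast
  have eq: "weak_KAM_eq S c (Sbar S c) u" using assms(4) unfolding weak_KAM_solution_def .
  interpret twist_kernel "\<lambda>x y. Sc S c (x, y)" "\<lambda>x y. d1 S (x, y) + c" "\<lambda>x y. d2 S (x, y) - c" \<epsilon>
    by (rule kernel)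
  interpret weak_kam "\<lambda>x y. Sc S c (x, y)" "\<lambda>x y. d1 S (x, y) + c" "\<lambda>x y. d2 S (x, y) - c" \<epsilon> "Sbar S c" u
    by unfold_locales (use eq weak_KAM_eq_iff_kam_solution in blast)
  have rel: "Lam_rel S c u x y \<longleftrightarrow> y = g x" for x y
  proof -
    have max: "u y' - Sc S c (x, y') \<le> u (g x) - Sc S c (x, g x)" for y'
      using maximizer_iff[of x "g x"] unfolding maximizer_def by blast
    hence sup: "Tplus S c u x = u (g x) - Sc S c (x, g x)"
      unfolding Tplus_def by (intro cSup_eq_maximum) auto
    have "Lam_rel S c u x y \<longleftrightarrow> maximizer x y"
      unfolding Lam_rel_def sup maximizer_def using max by (metis order_antisym order_refl)
    thus ?thesis using maximizer_iff by blast
  qed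
  have Lam: "?\<Lambda> (x, p) = (g x, d2 S (x, g x))" for x p
    unfolding Lam_def rel by (simp add: Let_def)
  have fst_Lam: "fst (?\<Lambda> z) = g (fst z)" for z using Lam[of "fst z" "snd z"] by simp
  have fst_pow: "fst ((?\<Lambda> ^^ n) (x, p)) = (g ^^ n) x" for n x p
    by (induction n) (simp_all add: fst_Lam)
  have image: "(g x, d2 S (x, g x)) \<in> ?G" "d2 S (x, g x) \<in> (+) c ` superdiff u (g x)" for x
  proof -
    have "d2 S (x, g x) = c + (d2 S (x, g x) - c)" by simp
    thus "(g x, d2 S (x, g x)) \<in> ?G" "d2 S (x, g x) \<in> (+) c ` superdiff u (g x)"
      using maximizer_superdiff[of x] unfolding pseudo_graph_def by blast+
  qed
  have 1: "\<forall>(x, p) \<in> ?G. \<exists>!y. Lam_rel S c u x y" unfolding rel by auto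
  have 2: "?\<Lambda> \<in> ?G \<rightarrow> ?G" using image(1) Lam by auto
  have 3: "\<forall>(x, p) \<in> ?G. (x + 1, p) \<in> ?G \<and> ?\<Lambda> (x + 1, p) = ?\<Lambda> (x, p) + (1, 0)"
  proof (intro ballI, clarify, intro conjI)
    fix x p assume "(x, p) \<in> ?G"
    thus "(x + 1, p) \<in> ?G" using superdiff_periodic[of u x] u_per unfolding pseudo_graph_def by blast
    have "d2 S (x + 1, g x + 1) = d2 S (x, g x)"
      using DERIV_unique[OF DERIV2[of "x + 1" "g x + 1", unfolded DERIV_shift per] DERIV2[of x "g x"]] by simp
    thus "?\<Lambda> (x + 1, p) = ?\<Lambda> (x, p) + (1, 0)" unfolding Lam g_per by simp
  qed
  have 4: "\<exists>L. L-lipschitz_on ?G ?\<Lambda>"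
  proof -
    obtain L1 where L1: "L1 \<ge> 0" "\<And>x x'. \<bar>g x - g x'\<bar> \<le> L1 * \<bar>x - x'\<bar>" using g_lipschitz by blast
    obtain L2 where L2: "L2 \<ge> 0" "\<And>x x'. \<bar>d2 S (x, g x) - d2 S (x', g x')\<bar> \<le> L2 * \<bar>x - x'\<bar>"
      using h2_graph_lipschitz by auto
    have "(L1 + L2)-lipschitz_on ?G ?\<Lambda>"
    proof (rule lipschitz_onI)
      fix z w :: "real \<times> real"
      have "dist (?\<Lambda> z) (?\<Lambda> w) \<le> \<bar>g (fst z) - g (fst w)\<bar> + \<bar>d2 S (fst z, g (fst z)) - d2 S (fst w, g (fst w))\<bar>"
        using Lam[of "fst z" "snd z"] Lam[of "fst w" "snd w"]
        by (simp add: dist_norm norm_Pair_le[THEN order_trans])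
      also have "\<dots> \<le> (L1 + L2) * \<bar>fst z - fst w\<bar>"
        using L1(2)[of "fst z" "fst w"] L2(2)[of "fst z" "fst w"] by (simp add: algebra_simps)
      also have "\<dots> \<le> (L1 + L2) * dist z w"
        using dist_fst_le[of z w] L1(1) L2(1) by (intro mult_left_mono) (auto simp: dist_real_def)
      finally show "dist (?\<Lambda> z) (?\<Lambda> w) \<le> (L1 + L2) * dist z w" .
    qed (use L1 L2 in simp)
    thus ?thesis by blast
  qed
  have 5: "monotone_on ?G pg_le pg_le ?\<Lambda>"
  proof (rule monotone_onI)
    fix z w assume "pg_le z w"
    hence le: "fst z \<le> fst w" unfolding pg_le_def by auto
    have "0 \<le> \<epsilon> * (fst w - fst z)" using eps le by simp
    hence "d2 S (fst w, y) \<le> d2 S (fst z, y)" for y using h2_twist[OF le, of y] by linarith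
    thus "pg_le (?\<Lambda> z) (?\<Lambda> w)"
      using g_mono[OF le] Lam[of "fst z" "snd z"] Lam[of "fst w" "snd w"] unfolding pg_le_def by auto
  qed
  have 6: "\<forall>V \<in> vertical_segments c u. \<exists>z. ?\<Lambda> ` V = {z} \<and> (\<exists>V' \<in> vertical_segments c u. z \<in> V')"
  proof
    fix V assume "V \<in> vertical_segments c u"
    then obtain x where x: "x \<in> Sing u" "V = {x} \<times> ((+) c ` superdiff u x)"
      unfolding vertical_segments_def by blast
    have "?\<Lambda> ` V = (\<lambda>_. (g x, d2 S (x, g x))) ` V"
      by (rule image_cong[OF refl]) (auto simp: x(2) Lam)
    also have "\<dots> = {(g x, d2 S (x, g x))}"
      using superdiff_nonempty[of x] unfolding x(2) by (simp add: image_constant_conv)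
    finally have *: "?\<Lambda> ` V = {(g x, d2 S (x, g x))}" .
    have **: "{g x} \<times> ((+) c ` superdiff u (g x)) \<in> vertical_segments c u"
      using g_singular[OF x(1)] unfolding vertical_segments_def by blast
    show "\<exists>z. ?\<Lambda> ` V = {z} \<and> (\<exists>V' \<in> vertical_segments c u. z \<in> V')"
      by (intro exI conjI bexI, rule *, rule SigmaI, rule singletonI, rule image(2), rule **)
  qed
  have 7: "\<exists>\<rho>. (\<forall>(x, p) \<in> ?G. (\<lambda>n. 1 / real n * (fst ((?\<Lambda> ^^ n) (x, p)) - x)) \<longlonglongrightarrow> \<rho>)
            \<and> (mather_alpha S has_real_derivative \<rho>) (at c)"
  proof -
    obtain \<rho> where \<rho>: "has_rotation_number \<rho>" using ex_rotation_number by blast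
    have "(mather_alpha S has_real_derivative \<rho>) (at c)"
      by (rule mather_alpha_has_derivative_rotation_number[OF kernel weak_KAM_eq_Sbar[OF assms(3)] eq \<rho>])
    moreover have "\<forall>(x, p) \<in> ?G. (\<lambda>n. 1 / real n * (fst ((?\<Lambda> ^^ n) (x, p)) - x)) \<longlonglongrightarrow> \<rho>"
      unfolding fst_pow split_beta by (intro ballI has_rotation_number_tendsto[OF \<rho>])
    ultimately show ?thesis by (intro exI conjI)
  qed
  show ?thesis using 1 2 3 4 5 6 7 by (intro conjI)
qed

end
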